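(* A totally geodesic almost complex surface $M$ of the nearly Kähler manifold $(SL(2,\mathbb{R})\times SL(2,\mathbb{R}),g,J)$ for which $P$ maps tangent vectors into normal vectors is isometric (i.e. congruent by an isometry of the ambient space) to the immersion $(A,B)$ given by $$A=\begin{pmatrix}\frac{\sqrt3 y_1}{2}+\frac12&\frac{\sqrt3}{2}(y_2+y_3)\\ \frac{\sqrt3}{2}(y_2-y_3)&\frac12-\frac{\sqrt3 y_1}{2}\end{pmatrix},\qquad B=\begin{pmatrix}\frac12-\frac{\sqrt3 y_1}{2}&-\frac{\sqrt3}{2}(y_2+y_3)\\ -\frac{\sqrt3}{2}(y_2-y_3)&\frac{\sqrt3 y_1}{2}+\frac12\end{pmatrix},$$ where $(y_1,y_2,y_3)$ is a point of the hyperbolic quadric $y_1^2+y_2^2-y_3^2=-1$ in $\mathbb{R}^3$ (locally parametrized by two parameters $(s,t)$).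
   Context: For trace-zero real $2\times2$ matrices put $\langle\alpha,\beta\rangle=\tfrac12\operatorname{Trace}(\alpha\beta)$. One has $T_ASL(2,\mathbb{R})=\{A\alpha:\operatorname{Trace}\alpha=0\}$, so tangent vectors of $SL(2,\mathbb{R})\times SL(2,\mathbb{R})$ at $(A,B)$ are the pairs $(A\alpha,B\beta)$ with $\alpha,\beta$ real $2\times 2$ matrices of trace $0$. The pseudo-Riemannian metric $g$, the almost complex structure $J$ and the almost product structure $P$ are $$g((A\alpha,B\beta),(A\gamma,B\delta))=\tfrac23\big(\langle\alpha,\gamma\rangle+\langle\beta,\delta\rangle\big)-\tfrac13\big(\langle\beta,\gamma\rangle+\langle\alpha,\delta\rangle\big),$$ $$J(A\alpha,B\beta)=\tfrac{1}{\sqrt3}\big(A(\alpha-2\beta),B(2\alpha-\beta)\big),\qquad P(A\alpha,B\beta)=(A\beta,B\alpha).$$ With these, $(SL(2,\mathbb{R})\times SL(2,\mathbb{R}),g,J)$ is a nearly Kähler manifold. An almost complex surface is an immersed 2-dimensional connected submanifold $M$ (with immersion $F$) whose tangent spaces are $J$-invariant; it is always assumed regular, i.e. the metric induced by $g$ is non-degenerate (hence positive or negative definite). Normal spaces and the second fundamental form $h$ are taken with respect to $g$; totally geodesic means $h=0$. $M$ is congruent to a surface with image $\Sigma\subset SL(2,\mathbb{R})\times SL(2,\mathbb{R})$ if there is an isometry $\Phi$ of $(SL(2,\mathbb{R})\times SL(2,\mathbb{R}),g)$ such that $\Phi(F(M))$ is an open part of $\Sigma$. *)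

theory Defs
  imports "HOL-Analysis.Analysis"
begin

section \<open>Smooth maps\<close>

text \<open>To be used on open sets: all directional derivatives of all orders up to \<open>k\<close> exist (as
  Frechet derivatives) and are continuous.\<close>

primrec Ck_on :: "nat \<Rightarrow> 'a::real_normed_vector set \<Rightarrow> ('a \<Rightarrow> 'b::real_normed_vector) \<Rightarrow> bool" where
  "Ck_on 0 S f \<longleftrightarrow> continuous_on S f"
| "Ck_on (Suc k) S f \<longleftrightarrow> (\<forall>x\<in>S. f differentiable at x) \<and>
     (\<forall>v. Ck_on k S (\<lambda>x. frechet_derivative f (at x) v))"

definition smooth_on :: "'a::real_normed_vector set \<Rightarrow> ('a \<Rightarrow> 'b::real_normed_vector) \<Rightarrow> bool" where
  "smooth_on S f \<longleftrightarrow> (\<forall>k. Ck_on k S f)"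


section \<open>The product of two copies of SL(2,R) as a submanifold of matrix space\<close>

type_synonym mat2 = "real^2^2"
type_synonym mpair = "mat2 \<times> mat2"

definition SL2 :: "mat2 set" where
  "SL2 = {A. det A = 1}"

definition sl2 :: "mat2 set" where
  "sl2 = {\<alpha>. trace \<alpha> = 0}"

abbreviation SLSL :: "mpair set" where
  "SLSL \<equiv> SL2 \<times> SL2"

definition ltrans :: "mpair \<Rightarrow> mpair \<Rightarrow> mpair" where
  "ltrans p \<xi> = (fst p ** fst \<xi>, snd p ** snd \<xi>)"

text \<open>The inverse of left translation: it recovers \<open>(\<alpha>, \<beta>)\<close> from \<open>(A\<alpha>, B\<beta>)\<close>.\<close>

definition lpull :: "mpair \<Rightarrow> mpair \<Rightarrow> mpair" where
  "lpull p u = (matrix_inv (fst p) ** fst u, matrix_inv (snd p) ** snd u)"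

definition tangent_SLSL :: "mpair \<Rightarrow> mpair set" where
  "tangent_SLSL p = ltrans p ` (sl2 \<times> sl2)"

definition trace_form :: "mat2 \<Rightarrow> mat2 \<Rightarrow> real" where
  "trace_form \<alpha> \<beta> = trace (\<alpha> ** \<beta>) / 2"

definition g :: "mpair \<Rightarrow> mpair \<Rightarrow> mpair \<Rightarrow> real" where
  "g p u v = (let (\<alpha>, \<beta>) = lpull p u; (\<gamma>, \<delta>) = lpull p v in
     2/3 * (trace_form \<alpha> \<gamma> + trace_form \<beta> \<delta>) - 1/3 * (trace_form \<beta> \<gamma> + trace_form \<alpha> \<delta>))"

definition J :: "mpair \<Rightarrow> mpair \<Rightarrow> mpair" where
  "J p u = (let (\<alpha>, \<beta>) = lpull p u in
     (1 / sqrt 3) *\<^sub>R ltrans p (\<alpha> - 2 *\<^sub>R \<beta>, 2 *\<^sub>R \<alpha> - \<beta>))"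

definition P :: "mpair \<Rightarrow> mpair \<Rightarrow> mpair" where
  "P p u = (let (\<alpha>, \<beta>) = lpull p u in ltrans p (\<beta>, \<alpha>))"

text \<open>Smoothness of a map on the closed submanifold \<open>SLSL\<close>, in terms of ambient smooth extensions.\<close>

definition smooth_near_SLSL :: "(mpair \<Rightarrow> 'b::real_normed_vector) \<Rightarrow> bool" where
  "smooth_near_SLSL f \<longleftrightarrow> (\<exists>U. open U \<and> SLSL \<subseteq> U \<and> smooth_on U f)"

definition isometry_SLSL :: "(mpair \<Rightarrow> mpair) \<Rightarrow> bool" where
  "isometry_SLSL \<Phi> \<longleftrightarrow>
     smooth_near_SLSL \<Phi> \<and> \<Phi> ` SLSL \<subseteq> SLSL \<and>
     (\<exists>\<Psi>. smooth_near_SLSL \<Psi> \<and> \<Psi> ` SLSL \<subseteq> SLSL \<and>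
        (\<forall>p\<in>SLSL. \<Psi> (\<Phi> p) = p \<and> \<Phi> (\<Psi> p) = p)) \<and>
     (\<forall>p\<in>SLSL. \<forall>u\<in>tangent_SLSL p. \<forall>v\<in>tangent_SLSL p.
        g (\<Phi> p) (frechet_derivative \<Phi> (at p) u) (frechet_derivative \<Phi> (at p) v) = g p u v)"


section \<open>The Levi-Civita connection\<close>

definition vector_field :: "(mpair \<Rightarrow> mpair) \<Rightarrow> bool" where
  "vector_field X \<longleftrightarrow> smooth_near_SLSL X \<and> (\<forall>p\<in>SLSL. X p \<in> tangent_SLSL p)"

text \<open>Along \<open>SLSL\<close> the Lie bracket of tangent fields only depends on their restrictions to \<open>SLSL\<close>,
  since the derivatives are taken in tangential directions.\<close>

definition lie_bracket :: "(mpair \<Rightarrow> mpair) \<Rightarrow> (mpair \<Rightarrow> mpair) \<Rightarrow> mpair \<Rightarrow> mpair" where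
  "lie_bracket X Y p = frechet_derivative Y (at p) (X p) - frechet_derivative X (at p) (Y p)"

text \<open>A connection is given as \<open>D p v Y\<close>, the covariant derivative of the field \<open>Y\<close> at \<open>p\<close> in the
  direction of the tangent vector \<open>v\<close>.\<close>

definition affine_connection :: "(mpair \<Rightarrow> mpair \<Rightarrow> (mpair \<Rightarrow> mpair) \<Rightarrow> mpair) \<Rightarrow> bool" where
  "affine_connection D \<longleftrightarrow>
     (\<forall>X Y. vector_field X \<longrightarrow> vector_field Y \<longrightarrow>
        (\<exists>Z. vector_field Z \<and> (\<forall>p\<in>SLSL. D p (X p) Y = Z p))) \<and>
     (\<forall>Y. vector_field Y \<longrightarrow> (\<forall>p\<in>SLSL.
        (\<forall>v\<in>tangent_SLSL p. D p v Y \<in> tangent_SLSL p) \<and>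
        (\<forall>v\<in>tangent_SLSL p. \<forall>w\<in>tangent_SLSL p. \<forall>a b.
           D p (a *\<^sub>R v + b *\<^sub>R w) Y = a *\<^sub>R D p v Y + b *\<^sub>R D p w Y))) \<and>
     (\<forall>Y Z. vector_field Y \<longrightarrow> vector_field Z \<longrightarrow> (\<forall>p\<in>SLSL. \<forall>v\<in>tangent_SLSL p.
        D p v (\<lambda>q. Y q + Z q) = D p v Y + D p v Z)) \<and>
     (\<forall>f Y. smooth_near_SLSL f \<longrightarrow> vector_field Y \<longrightarrow> (\<forall>p\<in>SLSL. \<forall>v\<in>tangent_SLSL p.
        D p v (\<lambda>q. f q *\<^sub>R Y q) = frechet_derivative f (at p) v *\<^sub>R Y p + f p *\<^sub>R D p v Y))"

definition levi_civita :: "(mpair \<Rightarrow> mpair \<Rightarrow> (mpair \<Rightarrow> mpair) \<Rightarrow> mpair) \<Rightarrow> bool" where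
  "levi_civita D \<longleftrightarrow> affine_connection D \<and>
     (\<forall>X Y. vector_field X \<longrightarrow> vector_field Y \<longrightarrow>
        (\<forall>p\<in>SLSL. D p (X p) Y - D p (Y p) X = lie_bracket X Y p)) \<and>
     (\<forall>Y Z. vector_field Y \<longrightarrow> vector_field Z \<longrightarrow> (\<forall>p\<in>SLSL. \<forall>v\<in>tangent_SLSL p.
        frechet_derivative (\<lambda>q. g q (Y q) (Z q)) (at p) v = g p (D p v Y) (Z p) + g p (Y p) (D p v Z)))"


section \<open>Immersed surfaces\<close>

type_synonym 'm chart = "'m set \<times> ('m \<Rightarrow> real^2)"

definition smooth_surface :: "'m topology \<Rightarrow> 'm chart set \<Rightarrow> bool" where
  "smooth_surface M \<A> \<longleftrightarrow>
     Hausdorff_space M \<and> second_countable M \<and> (\<Union>(U, \<phi>)\<in>\<A>. U) = topspace M \<and>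
     (\<forall>(U, \<phi>)\<in>\<A>. openin M U \<and> open (\<phi> ` U) \<and>
        homeomorphic_map (subtopology M U) (top_of_set (\<phi> ` U)) \<phi>) \<and>
     (\<forall>(U, \<phi>)\<in>\<A>. \<forall>(V, \<psi>)\<in>\<A>. smooth_on (\<phi> ` (U \<inter> V)) (\<psi> \<circ> inv_into U \<phi>))"

definition in_chart :: "('m \<Rightarrow> 'b) \<Rightarrow> 'm chart \<Rightarrow> real^2 \<Rightarrow> 'b" where
  "in_chart F c = F \<circ> inv_into (fst c) (snd c)"

definition chart_range :: "'m chart \<Rightarrow> (real^2) set" where
  "chart_range c = snd c ` fst c"

definition immersion_SLSL :: "'m topology \<Rightarrow> 'm chart set \<Rightarrow> ('m \<Rightarrow> mpair) \<Rightarrow> bool" where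
  "immersion_SLSL M \<A> F \<longleftrightarrow> F ` topspace M \<subseteq> SLSL \<and>
     (\<forall>c\<in>\<A>. smooth_on (chart_range c) (in_chart F c) \<and>
        (\<forall>x\<in>chart_range c. inj (frechet_derivative (in_chart F c) (at x))))"

text \<open>Below, \<open>f\<close> is the coordinate expression of an immersion in a chart and \<open>x\<close> a point of the
  coordinate domain.\<close>

definition tangent_plane :: "(real^2 \<Rightarrow> mpair) \<Rightarrow> real^2 \<Rightarrow> mpair set" where
  "tangent_plane f x = range (frechet_derivative f (at x))"

definition normal_space :: "(real^2 \<Rightarrow> mpair) \<Rightarrow> real^2 \<Rightarrow> mpair set" where
  "normal_space f x = {n \<in> tangent_SLSL (f x). \<forall>u\<in>tangent_plane f x. g (f x) n u = 0}"

definition almost_complex_surface :: "'m topology \<Rightarrow> 'm chart set \<Rightarrow> ('m \<Rightarrow> mpair) \<Rightarrow> bool" where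
  "almost_complex_surface M \<A> F \<longleftrightarrow>
     smooth_surface M \<A> \<and> connected_space M \<and> immersion_SLSL M \<A> F \<and>
     (\<forall>c\<in>\<A>. \<forall>x\<in>chart_range c. let f = in_chart F c in
        J (f x) ` tangent_plane f x \<subseteq> tangent_plane f x \<and>
        (\<forall>u\<in>tangent_plane f x. (\<forall>v\<in>tangent_plane f x. g (f x) u v = 0) \<longrightarrow> u = 0))"

text \<open>The pullback along \<open>f\<close> of the connection \<open>D\<close>, applied to a vector field \<open>W\<close> along \<open>f\<close> and the
  constant coordinate field \<open>v\<close>.  Write \<open>W y = ltrans (f y) (w y)\<close> with \<open>w y \<in> sl2 \<times> sl2\<close>, i.e. expand
  \<open>W\<close> in a frame of left-invariant fields, and use the Leibniz rule: the coefficients \<open>w\<close> are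
  differentiated in direction \<open>v\<close>, and \<open>D\<close> is applied to the left-invariant field
  \<open>\<lambda>q. ltrans q (w x)\<close> in direction \<open>df v\<close>.\<close>

definition cov_along :: "(mpair \<Rightarrow> mpair \<Rightarrow> (mpair \<Rightarrow> mpair) \<Rightarrow> mpair) \<Rightarrow> (real^2 \<Rightarrow> mpair) \<Rightarrow>
    real^2 \<Rightarrow> real^2 \<Rightarrow> (real^2 \<Rightarrow> mpair) \<Rightarrow> mpair" where
  "cov_along D f x v W = (let w = (\<lambda>y. lpull (f y) (W y)) in
     ltrans (f x) (frechet_derivative w (at x) v) +
     D (f x) (frechet_derivative f (at x) v) (\<lambda>q. ltrans q (w x)))"

text \<open>The second fundamental form on the constant coordinate fields \<open>v\<close>, \<open>w\<close>: the normal component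
  of the covariant derivative of \<open>df w\<close> in direction \<open>v\<close>.  The decomposition into a normal and a
  tangential part is unique when the induced metric is non-degenerate.\<close>

definition second_fundamental_form :: "(mpair \<Rightarrow> mpair \<Rightarrow> (mpair \<Rightarrow> mpair) \<Rightarrow> mpair) \<Rightarrow>
    (real^2 \<Rightarrow> mpair) \<Rightarrow> real^2 \<Rightarrow> real^2 \<Rightarrow> real^2 \<Rightarrow> mpair" where
  "second_fundamental_form D f x v w = (THE n. n \<in> normal_space f x \<and>
     cov_along D f x v (\<lambda>y. frechet_derivative f (at y) w) - n \<in> tangent_plane f x)"

definition totally_geodesic :: "(mpair \<Rightarrow> mpair \<Rightarrow> (mpair \<Rightarrow> mpair) \<Rightarrow> mpair) \<Rightarrow>
    'm chart set \<Rightarrow> ('m \<Rightarrow> mpair) \<Rightarrow> bool" where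
  "totally_geodesic D \<A> F \<longleftrightarrow>
     (\<forall>c\<in>\<A>. \<forall>x\<in>chart_range c. \<forall>v w. second_fundamental_form D (in_chart F c) x v w = 0)"

definition P_tangent_to_normal :: "'m chart set \<Rightarrow> ('m \<Rightarrow> mpair) \<Rightarrow> bool" where
  "P_tangent_to_normal \<A> F \<longleftrightarrow>
     (\<forall>c\<in>\<A>. \<forall>x\<in>chart_range c. let f = in_chart F c in
        P (f x) ` tangent_plane f x \<subseteq> normal_space f x)"

definition congruent_to_part_of :: "'m topology \<Rightarrow> ('m \<Rightarrow> mpair) \<Rightarrow> mpair set \<Rightarrow> bool" where
  "congruent_to_part_of M F \<Sigma> \<longleftrightarrow>
     (\<exists>\<Phi>. isometry_SLSL \<Phi> \<and> openin (top_of_set \<Sigma>) (\<Phi> ` F ` topspace M))"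


section \<open>The model surface\<close>

definition model_A :: "real \<Rightarrow> real \<Rightarrow> real \<Rightarrow> mat2" where
  "model_A y1 y2 y3 = vector
     [vector [sqrt 3 * y1 / 2 + 1/2, sqrt 3 / 2 * (y2 + y3)],
      vector [sqrt 3 / 2 * (y2 - y3), 1/2 - sqrt 3 * y1 / 2]]"

definition model_B :: "real \<Rightarrow> real \<Rightarrow> real \<Rightarrow> mat2" where
  "model_B y1 y2 y3 = vector
     [vector [1/2 - sqrt 3 * y1 / 2, - (sqrt 3 / 2 * (y2 + y3))],
      vector [- (sqrt 3 / 2 * (y2 - y3)), sqrt 3 * y1 / 2 + 1/2]]"

definition model_surface :: "mpair set" where
  "model_surface =
     {(model_A y1 y2 y3, model_B y1 y2 y3) | y1 y2 y3. y1\<^sup>2 + y2\<^sup>2 - y3\<^sup>2 = -1}"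

end

theory Submission
  imports Defs
begin

text \<open>
  Left translation identifies every tangent space of \<open>SLSL\<close> with pairs \<open>(\<alpha>, \<beta>)\<close> of
  trace-zero matrices, on which the metric, \<open>J\<close>, \<open>P\<close> and the Levi-Civita derivative of
  left-invariant fields are given by constant formulas.  For a plane that is \<open>J\<close>-invariant and
  that \<open>P\<close> maps into its normal space, the metric gives
  \<open>\<langle>\<alpha>,\<alpha>\<rangle> = \<langle>\<beta>,\<beta>\<rangle> = 2 \<langle>\<alpha>,\<beta>\<rangle>\<close> on the plane.  By the Clifford relation
  \<open>\<alpha>\<beta> + \<beta>\<alpha> = 2 \<langle>\<alpha>,\<beta>\<rangle>\<close> this means that \<open>\<beta>\<close> is \<open>\<alpha>\<close> turned by sixty degrees: there is one
  matrix \<open>\<rho>\<close> with trace and determinant \<open>1\<close> such that \<open>\<beta> = \<rho> \<alpha>\<close> and \<open>\<alpha> \<rho> = (1 - \<rho>) \<alpha>\<close> for all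
  \<open>(\<alpha>, \<beta>)\<close> in the plane (\<open>special_plane_turn\<close>).  So \<open>\<rho>\<^sup>2 = \<rho> - 1\<close>, and \<open>1 - \<rho>\<close> is the inverse
  of \<open>\<rho>\<close>.

  Along a surface \<open>(A, B)\<close> the matrix \<open>\<rho>\<close> varies.  The Koszul formula
  (\<open>levi_civita_left_invariant\<close>) turns the vanishing of the second fundamental form into the
  differential equation \<open>d\<rho>(v) = - \<alpha>(v) \<rho>\<close>, where \<open>\<alpha> = A\<^sup>-\<^sup>1 dA\<close>
  (\<open>turn_structure_equation\<close>, \<open>turn_derivative\<close>).  This says exactly that \<open>A \<rho>\<close> and
  \<open>B (1 - \<rho>)\<close> have derivative zero (\<open>left_factor_derivative\<close>).  As \<open>\<rho>\<close> depends only on the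
  tangent plane, these two matrices are well-defined functions on the connected surface and hence
  constants \<open>C\<close> and \<open>E\<close>.  The isometry \<open>(A, B) \<mapsto> (C\<^sup>-\<^sup>1 A, E\<^sup>-\<^sup>1 B)\<close> moves the surface into
  the set of all \<open>(1 - \<rho>, \<rho>)\<close> with \<open>\<rho>\<close> of trace and determinant \<open>1\<close>, which is the model surface
  (\<open>model_surface_eq\<close>).  Finally \<open>\<rho>\<close> is an immersion of a surface into the model surface, so its
  image is open there by the inverse function theorem (\<open>turn_open_in_model\<close>).
\<close>

section \<open>Matrices of size two\<close>

interpretation mm: bounded_bilinear "(**) :: mat2 \<Rightarrow> mat2 \<Rightarrow> mat2"
proof (rule bilinear_conv_bounded_bilinear[THEN iffD1])
  show "bilinear ((**) :: mat2 \<Rightarrow> mat2 \<Rightarrow> mat2)"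
    unfolding bilinear_def linear_iff
    by (simp add: vec_eq_iff matrix_matrix_mult_def sum_2 algebra_simps)
qed

lemmas mm_expand = mm.add_left mm.add_right mm.diff_left mm.diff_right mm.scaleR_left mm.scaleR_right
  mm.minus_left mm.minus_right matrix_mul_assoc[symmetric]

lemmas mat2_entries = vec_eq_iff forall_2 matrix_matrix_mult_def sum_2 trace_def mat_def det_2

text \<open>The adjugate matrix. In this form it is visibly linear, so that on \<open>SL2\<close>, where it is the
  inverse, differentiating the inverse needs no quotient rule.\<close>

definition adj2 :: "mat2 \<Rightarrow> mat2" where
  "adj2 A = trace A *\<^sub>R mat 1 - A"

lemma bounded_linear_trace: "bounded_linear (trace :: mat2 \<Rightarrow> real)"
  by (rule linear_conv_bounded_linear[THEN iffD1])
     (simp add: linear_iff trace_def sum.distrib sum_distrib_left)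

lemma bounded_linear_adj2: "bounded_linear adj2"
  by (rule linear_conv_bounded_linear[THEN iffD1])
     (simp add: linear_iff adj2_def mat2_entries algebra_simps)

lemma adj2_mult: "adj2 A ** A = det A *\<^sub>R mat 1" "A ** adj2 A = det A *\<^sub>R mat 1"
  by (simp_all add: adj2_def mat2_entries algebra_simps)

lemma matrix_inv_adj2:
  fixes A :: mat2
  assumes "det A \<noteq> 0"
  shows "matrix_inv A = (1 / det A) *\<^sub>R adj2 A" (is "_ = ?B")
proof -
  have B: "A ** ?B = mat 1" "?B ** A = mat 1"
    using assms by (simp_all add: mm_expand adj2_mult)
  have inv: "A ** matrix_inv A = mat 1 \<and> matrix_inv A ** A = mat 1"
    unfolding matrix_inv_def by (rule someI[of _ ?B]) (use B in simp)
  have "matrix_inv A = ?B ** (A ** matrix_inv A)"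
    by (simp add: matrix_mul_assoc B)
  then show ?thesis using inv by simp
qed

lemma matrix_inv_SL2: "A \<in> SL2 \<Longrightarrow> matrix_inv A = adj2 A"
  by (simp add: SL2_def matrix_inv_adj2)

lemma matrix_inv_mult:
  fixes A :: mat2
  assumes "det A \<noteq> 0"
  shows "matrix_inv A ** A = mat 1" "A ** matrix_inv A = mat 1"
  using assms by (simp_all add: matrix_inv_adj2 mm_expand adj2_mult)

lemma matrix_inv_in_SL2:
  assumes "A \<in> SL2"
  shows "matrix_inv A \<in> SL2"
proof -
  have "det (matrix_inv A ** A) = 1"
    using assms by (simp add: matrix_inv_mult SL2_def)
  then show ?thesis using assms by (simp add: det_mul SL2_def)
qed

lemma SL2_mult: "A \<in> SL2 \<Longrightarrow> B \<in> SL2 \<Longrightarrow> A ** B \<in> SL2"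
  by (simp add: SL2_def det_mul)

lemma sl2_closed:
  "\<alpha> \<in> sl2 \<Longrightarrow> \<beta> \<in> sl2 \<Longrightarrow> \<alpha> + \<beta> \<in> sl2"
  "\<alpha> \<in> sl2 \<Longrightarrow> \<beta> \<in> sl2 \<Longrightarrow> \<alpha> - \<beta> \<in> sl2"
  "\<alpha> \<in> sl2 \<Longrightarrow> c *\<^sub>R \<alpha> \<in> sl2"
  using bounded_linear_trace by (simp_all add: sl2_def linear_simps)

definition commutator :: "mat2 \<Rightarrow> mat2 \<Rightarrow> mat2" where
  "commutator \<alpha> \<beta> = \<alpha> ** \<beta> - \<beta> ** \<alpha>"

lemma commutator_in_sl2: "commutator \<alpha> \<beta> \<in> sl2"
  by (simp add: commutator_def sl2_def trace_sub trace_mul_sym[of \<alpha> \<beta>])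

lemma commutator_swap: "commutator \<beta> \<alpha> = - commutator \<alpha> \<beta>"
  by (simp add: commutator_def)

text \<open>Polarized Cayley-Hamilton: with the trace form, \<open>sl2\<close> generates the \<open>2 \<times> 2\<close> matrices as a
  Clifford algebra, so orthogonality statements become commutation rules.\<close>

lemma clifford_relation:
  assumes "\<alpha> \<in> sl2" "\<beta> \<in> sl2"
  shows "\<alpha> ** \<beta> + \<beta> ** \<alpha> = (2 * trace_form \<alpha> \<beta>) *\<^sub>R mat 1"
proof -
  have "\<alpha> $ 2 $ 2 = - (\<alpha> $ 1 $ 1)" "\<beta> $ 2 $ 2 = - (\<beta> $ 1 $ 1)"
    using assms by (auto simp: sl2_def mat2_entries)
  then show ?thesis
    by (simp add: mat2_entries trace_form_def algebra_simps)
qed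

lemma square_in_sl2:
  assumes "\<alpha> \<in> sl2"
  shows "\<alpha> ** \<alpha> = trace_form \<alpha> \<alpha> *\<^sub>R mat 1"
proof -
  have "2 *\<^sub>R (\<alpha> ** \<alpha>) = 2 *\<^sub>R (trace_form \<alpha> \<alpha> *\<^sub>R mat 1)"
    using clifford_relation[OF assms assms] by (simp add: scaleR_2)
  then show ?thesis by (simp only: scaleR_cancel_left) simp
qed

lemma cayley_hamilton_2: "A ** A = trace A *\<^sub>R A - det A *\<^sub>R mat 1" for A :: mat2
  by (simp add: mat2_entries algebra_simps)

lemma bounded_bilinear_trace_form: "bounded_bilinear trace_form"
proof -
  have "bilinear trace_form"
    unfolding bilinear_def linear_iff trace_form_def
    using bounded_linear_trace by (simp add: mm_expand linear_simps add_divide_distrib)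
  then show ?thesis by (rule bilinear_conv_bounded_bilinear[THEN iffD1])
qed

interpretation tf: bounded_bilinear trace_form
  by (rule bounded_bilinear_trace_form)

lemma trace_form_sym: "trace_form \<alpha> \<beta> = trace_form \<beta> \<alpha>"
  by (simp add: trace_form_def trace_mul_sym[of \<alpha>])

text \<open>Pairing with the transpose gives the sum of the squares of the entries.\<close>

lemma trace_form_nondegenerate:
  assumes "\<xi> \<in> sl2" "\<And>\<eta>. \<eta> \<in> sl2 \<Longrightarrow> trace_form \<xi> \<eta> = 0"
  shows "\<xi> = 0"
proof -
  have "transpose \<xi> \<in> sl2"
    using assms(1) by (simp add: sl2_def trace_def transpose_def)
  then have "trace_form \<xi> (transpose \<xi>) = 0" by (rule assms(2))
  then have "(\<xi>$1$1)\<^sup>2 + (\<xi>$1$2)\<^sup>2 + (\<xi>$2$1)\<^sup>2 + (\<xi>$2$2)\<^sup>2 = 0"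
    by (simp add: trace_form_def mat2_entries transpose_def power2_eq_square)
  then have "\<xi>$1$1 = 0 \<and> \<xi>$1$2 = 0 \<and> \<xi>$2$1 = 0 \<and> \<xi>$2$2 = 0"
    by (smt (verit) zero_le_power2 zero_eq_power2)
  then show ?thesis by (simp add: mat2_entries)
qed

section \<open>Left-invariant fields and the Levi-Civita connection\<close>

text \<open>The suffix \<open>0\<close> marks the structures of \<open>SLSL\<close> carried to \<open>sl2 \<times> sl2\<close> by left translation.\<close>

definition metric0 :: "mpair \<Rightarrow> mpair \<Rightarrow> real" where
  "metric0 \<xi> \<eta> = 2/3 * (trace_form (fst \<xi>) (fst \<eta>) + trace_form (snd \<xi>) (snd \<eta>))
     - 1/3 * (trace_form (snd \<xi>) (fst \<eta>) + trace_form (fst \<xi>) (snd \<eta>))"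

definition bracket0 :: "mpair \<Rightarrow> mpair \<Rightarrow> mpair" where
  "bracket0 \<xi> \<eta> = (commutator (fst \<xi>) (fst \<eta>), commutator (snd \<xi>) (snd \<eta>))"

definition twist0 :: "mpair \<Rightarrow> mpair \<Rightarrow> mat2" where
  "twist0 \<xi> \<eta> = (1/3) *\<^sub>R (commutator (snd \<xi>) (fst \<eta>) - commutator (fst \<xi>) (snd \<eta>))"

text \<open>The Levi-Civita derivative of the left-invariant field \<open>\<eta>\<close> in the direction of \<open>\<xi>\<close>.  The
  metric is not bi-invariant, so half of the bracket has to be corrected by \<open>twist0\<close>.\<close>

definition nabla0 :: "mpair \<Rightarrow> mpair \<Rightarrow> mpair" where
  "nabla0 \<xi> \<eta> = (1/2) *\<^sub>R (bracket0 \<xi> \<eta> + (twist0 \<xi> \<eta>, - twist0 \<xi> \<eta>))"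

lemma metric0_sym: "metric0 \<xi> \<eta> = metric0 \<eta> \<xi>"
  by (simp add: metric0_def trace_form_sym)

lemma metric0_linear:
  "metric0 (\<xi> + \<xi>') \<eta> = metric0 \<xi> \<eta> + metric0 \<xi>' \<eta>"
  "metric0 (\<xi> - \<xi>') \<eta> = metric0 \<xi> \<eta> - metric0 \<xi>' \<eta>"
  "metric0 (c *\<^sub>R \<xi>) \<eta> = c * metric0 \<xi> \<eta>"
  "metric0 \<eta> (\<xi> + \<xi>') = metric0 \<eta> \<xi> + metric0 \<eta> \<xi>'"
  "metric0 \<eta> (\<xi> - \<xi>') = metric0 \<eta> \<xi> - metric0 \<eta> \<xi>'"
  "metric0 \<eta> (c *\<^sub>R \<xi>) = c * metric0 \<eta> \<xi>"
  by (simp_all add: metric0_def tf.add_left tf.add_right tf.diff_left tf.diff_right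
      tf.scaleR_left tf.scaleR_right algebra_simps)

lemma metric0_nondegenerate:
  assumes "\<xi> \<in> sl2 \<times> sl2" "\<And>\<eta>. \<eta> \<in> sl2 \<times> sl2 \<Longrightarrow> metric0 \<xi> \<eta> = 0"
  shows "\<xi> = 0"
proof -
  obtain \<alpha> \<beta> where \<xi>: "\<xi> = (\<alpha>, \<beta>)" "\<alpha> \<in> sl2" "\<beta> \<in> sl2" using assms(1) by auto
  have 0: "0 \<in> sl2" by (simp add: sl2_def trace_def)
  have "2 *\<^sub>R \<alpha> - \<beta> = 0"
  proof (rule trace_form_nondegenerate)
    fix \<eta> assume "\<eta> \<in> sl2"
    with assms(2)[of "(\<eta>, 0)"] 0 show "trace_form (2 *\<^sub>R \<alpha> - \<beta>) \<eta> = 0"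
      by (simp add: metric0_def \<xi> tf.diff_left tf.scaleR_left tf.zero_right)
  qed (simp add: \<xi> sl2_closed)
  moreover have "2 *\<^sub>R \<beta> - \<alpha> = 0"
  proof (rule trace_form_nondegenerate)
    fix \<eta> assume "\<eta> \<in> sl2"
    with assms(2)[of "(0, \<eta>)"] 0 show "trace_form (2 *\<^sub>R \<beta> - \<alpha>) \<eta> = 0"
      by (simp add: metric0_def \<xi> tf.diff_left tf.scaleR_left tf.zero_right)
  qed (simp add: \<xi> sl2_closed)
  moreover have "\<alpha> = (1/3) *\<^sub>R (2 *\<^sub>R (2 *\<^sub>R \<alpha> - \<beta>) + (2 *\<^sub>R \<beta> - \<alpha>))"
    by (simp add: vec_eq_iff)
  moreover have "\<beta> = (1/3) *\<^sub>R (2 *\<^sub>R (2 *\<^sub>R \<beta> - \<alpha>) + (2 *\<^sub>R \<alpha> - \<beta>))"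
    by (simp add: vec_eq_iff)
  ultimately have "\<alpha> = 0" "\<beta> = 0" by simp_all
  then show ?thesis by (simp add: \<xi> zero_prod_def)
qed

lemma nabla0_in: "nabla0 \<xi> \<eta> \<in> sl2 \<times> sl2"
proof -
  have "twist0 \<xi> \<eta> \<in> sl2" by (simp add: twist0_def sl2_closed commutator_in_sl2)
  moreover have "- twist0 \<xi> \<eta> \<in> sl2"
    using sl2_closed(3)[OF calculation, of "-1"] by simp
  ultimately show ?thesis
    by (simp add: nabla0_def bracket0_def commutator_in_sl2 sl2_closed)
qed

text \<open>The trace form is invariant under the adjoint action; this is what makes the Koszul formula
  solvable in closed form.\<close>

lemma triple_product_cyclic:
  "trace_form (commutator \<alpha> \<beta>) \<gamma> = trace_form (commutator \<gamma> \<alpha>) \<beta>"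
proof -
  have "trace (\<alpha> ** (\<beta> ** \<gamma>)) = trace (\<gamma> ** (\<alpha> ** \<beta>))" "trace (\<alpha> ** (\<gamma> ** \<beta>)) = trace (\<beta> ** (\<alpha> ** \<gamma>))"
    by (metis trace_mul_sym matrix_mul_assoc)+
  then show ?thesis
    by (simp add: trace_form_def commutator_def mm_expand trace_sub)
qed

lemma koszul_nabla0:
  "2 * metric0 (nabla0 \<xi> \<eta>) \<zeta> =
     metric0 (bracket0 \<xi> \<eta>) \<zeta> + metric0 (bracket0 \<zeta> \<xi>) \<eta> - metric0 (bracket0 \<eta> \<zeta>) \<xi>"
proof -
  obtain a b where 1: "\<xi> = (a, b)" by force
  obtain c d where 2: "\<eta> = (c, d)" by force
  obtain e f where 3: "\<zeta> = (e, f)" by force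
  note t = triple_product_cyclic
  show ?thesis
    unfolding metric0_def nabla0_def bracket0_def twist0_def 1 2 3
    using t[of a c e] t[of a c f] t[of a d e] t[of a d f] t[of b c e] t[of b c f] t[of b d e] t[of b d f]
      t[of e a c] t[of f a c] t[of e a d] t[of f a d] t[of e b c] t[of f b c] t[of e b d] t[of f b d]
    by (simp add: tf.add_left tf.add_right tf.diff_left tf.diff_right tf.minus_left tf.minus_right
      tf.scaleR_left tf.scaleR_right field_simps commutator_swap[of a c] commutator_swap[of c d])
qed

lemma SLSL_det: "p \<in> SLSL \<Longrightarrow> det (fst p) = 1 \<and> det (snd p) = 1"
  by (auto simp: SL2_def)

lemma lpull_ltrans:
  assumes "det (fst p) \<noteq> 0" "det (snd p) \<noteq> 0"
  shows "lpull p (ltrans p \<xi>) = \<xi>" "ltrans p (lpull p \<xi>) = \<xi>"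
  using assms by (simp_all add: lpull_def ltrans_def matrix_mul_assoc matrix_inv_mult)

lemma g_eq_metric0: "g p u v = metric0 (lpull p u) (lpull p v)"
  by (simp add: g_def metric0_def split_def Let_def)

lemma bounded_bilinear_ltrans: "bounded_bilinear ltrans"
proof (rule bilinear_conv_bounded_bilinear[THEN iffD1])
  show "bilinear ltrans"
    unfolding bilinear_def linear_iff by (simp add: ltrans_def mm_expand)
qed

interpretation ltrans: bounded_bilinear ltrans
  by (rule bounded_bilinear_ltrans)

lemma Ck_on_const: "Ck_on k S (\<lambda>x. c)"
  by (induction k arbitrary: c) (simp_all)

text \<open>The derivative of a linear map is constant, so the recursion stops after one step.\<close>

lemma Ck_on_bounded_linear:
  assumes "bounded_linear f"
  shows "Ck_on k S f"
proof (cases k)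
  case 0
  then show ?thesis by (simp add: assms linear_continuous_on)
next
  case (Suc j)
  have "frechet_derivative f (at x) = f" for x
    using assms bounded_linear_imp_has_derivative frechet_derivative_at by metis
  then show ?thesis
    using assms by (simp add: Suc bounded_linear_imp_differentiable Ck_on_const)
qed

lemma smooth_near_SLSL_bounded_linear: "bounded_linear f \<Longrightarrow> smooth_near_SLSL f"
  unfolding smooth_near_SLSL_def smooth_on_def
  by (metis Ck_on_bounded_linear open_UNIV subset_UNIV)

lemma left_invariant_vector_field:
  assumes "\<xi> \<in> sl2 \<times> sl2"
  shows "vector_field (\<lambda>q. ltrans q \<xi>)"
  unfolding vector_field_def tangent_SLSL_def
  using assms ltrans.bounded_linear_left smooth_near_SLSL_bounded_linear by blast

lemma left_invariant_derivative:
  "frechet_derivative (\<lambda>q. ltrans q \<xi>) (at p) = (\<lambda>v. ltrans v \<xi>)"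
  using ltrans.bounded_linear_left bounded_linear_imp_has_derivative frechet_derivative_at by metis

lemma left_invariant_lie_bracket:
  "lie_bracket (\<lambda>q. ltrans q \<xi>) (\<lambda>q. ltrans q \<eta>) p = ltrans p (bracket0 \<xi> \<eta>)"
  unfolding lie_bracket_def left_invariant_derivative
  by (simp add: ltrans_def bracket0_def commutator_def mm_expand)

text \<open>The derivative is taken in the ambient matrix space, but the metric is given there by the
  inverse matrices and so stays left-invariant on the open set of invertible pairs.\<close>

lemma left_invariant_metric_derivative:
  assumes "p \<in> SLSL"
  shows "frechet_derivative (\<lambda>q. g q (ltrans q \<xi>) (ltrans q \<eta>)) (at p) v = 0"
proof -
  define U where "U = {q :: mpair. det (fst q) \<noteq> 0 \<and> det (snd q) \<noteq> 0}"
  have "open U"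
    unfolding U_def det_2
    by (intro open_Collect_conj open_Collect_neq continuous_intros)
  moreover have "p \<in> U" using SLSL_det[OF assms] by (simp add: U_def)
  moreover have "metric0 \<xi> \<eta> = g q (ltrans q \<xi>) (ltrans q \<eta>)" if "q \<in> U" for q
    using that by (simp add: U_def g_eq_metric0 lpull_ltrans)
  ultimately have "((\<lambda>q. g q (ltrans q \<xi>) (ltrans q \<eta>)) has_derivative (\<lambda>_. 0)) (at p)"
    by (rule has_derivative_transform_within_open[OF has_derivative_const])
  then show ?thesis
    by (rule fun_cong[OF frechet_derivative_at[symmetric]])
qed

text \<open>On left-invariant fields the metric has constant coefficients, so torsion-freeness and metric
  compatibility alone reduce to the Koszul formula on \<open>sl2 \<times> sl2\<close>, which has a unique solution.\<close>

lemma levi_civita_left_invariant: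
  assumes D: "levi_civita D" and p: "p \<in> SLSL" and \<xi>: "\<xi> \<in> sl2 \<times> sl2" and \<eta>: "\<eta> \<in> sl2 \<times> sl2"
  shows "D p (ltrans p \<xi>) (\<lambda>q. ltrans q \<eta>) = ltrans p (nabla0 \<xi> \<eta>)"
proof -
  have inv: "det (fst p) \<noteq> 0" "det (snd p) \<noteq> 0" using SLSL_det[OF p] by auto
  define \<Gamma> where "\<Gamma> a b = lpull p (D p (ltrans p a) (\<lambda>q. ltrans q b))" for a b
  have tan: "ltrans p a \<in> tangent_SLSL p" if "a \<in> sl2 \<times> sl2" for a
    using that by (simp add: tangent_SLSL_def)
  have \<Gamma>: "D p (ltrans p a) (\<lambda>q. ltrans q b) = ltrans p (\<Gamma> a b)" for a b
    by (simp add: \<Gamma>_def lpull_ltrans inv)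
  have \<Gamma>_in: "\<Gamma> a b \<in> sl2 \<times> sl2" if "a \<in> sl2 \<times> sl2" "b \<in> sl2 \<times> sl2" for a b
  proof -
    have "D p (ltrans p a) (\<lambda>q. ltrans q b) \<in> tangent_SLSL p"
      using D left_invariant_vector_field[OF that(2)] tan[OF that(1)] p
      unfolding levi_civita_def affine_connection_def by blast
    then show ?thesis
      unfolding \<Gamma>_def tangent_SLSL_def by (auto simp: lpull_ltrans inv)
  qed
  have torsion: "\<Gamma> a b - \<Gamma> b a = bracket0 a b" if "a \<in> sl2 \<times> sl2" "b \<in> sl2 \<times> sl2" for a b
  proof -
    have "D p (ltrans p a) (\<lambda>q. ltrans q b) - D p (ltrans p b) (\<lambda>q. ltrans q a)
        = lie_bracket (\<lambda>q. ltrans q a) (\<lambda>q. ltrans q b) p"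
      using D left_invariant_vector_field[OF that(1)] left_invariant_vector_field[OF that(2)] p
      unfolding levi_civita_def by blast
    then have "ltrans p (\<Gamma> a b - \<Gamma> b a) = ltrans p (bracket0 a b)"
      by (simp add: \<Gamma> left_invariant_lie_bracket ltrans.diff_right)
    then show ?thesis by (metis lpull_ltrans(1) inv)
  qed
  have compat: "metric0 (\<Gamma> a b) c + metric0 b (\<Gamma> a c) = 0"
    if "a \<in> sl2 \<times> sl2" "b \<in> sl2 \<times> sl2" "c \<in> sl2 \<times> sl2" for a b c
  proof -
    have "frechet_derivative (\<lambda>q. g q (ltrans q b) (ltrans q c)) (at p) (ltrans p a) =
        g p (D p (ltrans p a) (\<lambda>q. ltrans q b)) (ltrans p c)
      + g p (ltrans p b) (D p (ltrans p a) (\<lambda>q. ltrans q c))"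
      using D left_invariant_vector_field[OF that(2)] left_invariant_vector_field[OF that(3)]
        tan[OF that(1)] p
      unfolding levi_civita_def by blast
    then show ?thesis
      using left_invariant_metric_derivative[OF p] by (simp add: \<Gamma> g_eq_metric0 lpull_ltrans inv)
  qed
  have "2 *\<^sub>R \<Gamma> \<xi> \<eta> - 2 *\<^sub>R nabla0 \<xi> \<eta> = 0"
  proof (rule metric0_nondegenerate)
    show "2 *\<^sub>R \<Gamma> \<xi> \<eta> - 2 *\<^sub>R nabla0 \<xi> \<eta> \<in> sl2 \<times> sl2"
      using \<Gamma>_in[OF \<xi> \<eta>] nabla0_in[of \<xi> \<eta>]
      by (auto simp: mem_Times_iff sl2_closed)
    fix \<zeta> :: mpair assume \<zeta>: "\<zeta> \<in> sl2 \<times> sl2"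
    \<comment> \<open>By metric compatibility, the first two torsion identities minus the third give the Koszul
      formula.\<close>
    have "metric0 (\<Gamma> \<xi> \<eta>) \<zeta> - metric0 (\<Gamma> \<eta> \<xi>) \<zeta> = metric0 (bracket0 \<xi> \<eta>) \<zeta>"
         "metric0 (\<Gamma> \<zeta> \<xi>) \<eta> - metric0 (\<Gamma> \<xi> \<zeta>) \<eta> = metric0 (bracket0 \<zeta> \<xi>) \<eta>"
         "metric0 (\<Gamma> \<eta> \<zeta>) \<xi> - metric0 (\<Gamma> \<zeta> \<eta>) \<xi> = metric0 (bracket0 \<eta> \<zeta>) \<xi>"
      by (simp_all add: torsion[symmetric] \<xi> \<eta> \<zeta> metric0_linear)
    then show "metric0 (2 *\<^sub>R \<Gamma> \<xi> \<eta> - 2 *\<^sub>R nabla0 \<xi> \<eta>) \<zeta> = 0"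
      using compat[OF \<xi> \<eta> \<zeta>] compat[OF \<eta> \<xi> \<zeta>] compat[OF \<zeta> \<xi> \<eta>] koszul_nabla0[of \<xi> \<eta> \<zeta>]
      by (simp add: metric0_linear metric0_sym)
  qed
  then have "\<Gamma> \<xi> \<eta> = nabla0 \<xi> \<eta>" by simp
  then show ?thesis by (simp add: \<Gamma>)
qed

section \<open>The tangent planes\<close>

definition J0 :: "mpair \<Rightarrow> mpair" where
  "J0 \<xi> = (1 / sqrt 3) *\<^sub>R (fst \<xi> - 2 *\<^sub>R snd \<xi>, 2 *\<^sub>R fst \<xi> - snd \<xi>)"

text \<open>The pointwise hypotheses on a tangent plane, moved to the identity: it is invariant under the
  almost complex structure, orthogonal to its image under the exchange of the two factors, which
  is what the almost product structure becomes, and the metric is non-degenerate on it.\<close>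

definition special_plane :: "mpair set \<Rightarrow> bool" where
  "special_plane V \<longleftrightarrow> subspace V \<and> dim V = 2 \<and> V \<subseteq> sl2 \<times> sl2 \<and> J0 ` V \<subseteq> V \<and>
     (\<forall>u\<in>V. \<forall>v\<in>V. metric0 (prod.swap u) v = 0) \<and>
     (\<forall>u\<in>V. (\<forall>v\<in>V. metric0 u v = 0) \<longrightarrow> u = 0)"

text \<open>The last clause says that \<open>\<rho>\<close> acts on the first components of \<open>V\<close> by left multiplication as a
  rotation by sixty degrees that produces the second components, and that moving \<open>\<rho>\<close> past a
  first component replaces it by its inverse \<open>1 - \<rho>\<close>.\<close>

definition is_turn :: "mat2 \<Rightarrow> mpair set \<Rightarrow> bool" where
  "is_turn \<rho> V \<longleftrightarrow> \<rho> \<in> SL2 \<and> trace \<rho> = 1 \<and>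
     (\<forall>u\<in>V. snd u = \<rho> ** fst u \<and> fst u ** \<rho> = fst u - \<rho> ** fst u)"

lemma J0_J0: "J0 (J0 \<xi>) = - \<xi>"
  by (simp add: J0_def prod_eq_iff algebra_simps flip: scaleR_left_distrib scaleR_left_diff_distrib)

lemma metric0_J0:
  "metric0 \<xi> (J0 \<xi>) = 0" "metric0 (J0 \<xi>) (J0 \<xi>) = metric0 \<xi> \<xi>"
proof -
  define \<kappa> where "\<kappa> = (fst \<xi> - 2 *\<^sub>R snd \<xi>, 2 *\<^sub>R fst \<xi> - snd \<xi>)"
  obtain a b c where abc: "trace_form (fst \<xi>) (fst \<xi>) = a" "trace_form (snd \<xi>) (snd \<xi>) = b"
    "trace_form (fst \<xi>) (snd \<xi>) = c" "trace_form (snd \<xi>) (fst \<xi>) = c"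
    using trace_form_sym by metis
  have "metric0 \<xi> \<kappa> = 0" "metric0 \<kappa> \<kappa> = 3 * metric0 \<xi> \<xi>"
    unfolding \<kappa>_def metric0_def fst_conv snd_conv tf.diff_left tf.diff_right tf.scaleR_left tf.scaleR_right abc
    by (simp_all add: field_simps)
  moreover have "J0 \<xi> = (1 / sqrt 3) *\<^sub>R \<kappa>" by (simp add: J0_def \<kappa>_def)
  ultimately show "metric0 \<xi> (J0 \<xi>) = 0" "metric0 (J0 \<xi>) (J0 \<xi>) = metric0 \<xi> \<xi>"
    by (simp_all only: metric0_linear) simp_all
qed

text \<open>As \<open>J0\<close> squares to \<open>-1\<close>, it has no real eigenvectors, so \<open>u\<close> and \<open>J0 u\<close> are independent.\<close>

lemma special_plane_span:
  assumes V: "special_plane V" and u: "u \<in> V" "u \<noteq> 0"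
  shows "V = span {u, J0 u}"
proof -
  have "subspace V" "dim V = 2" "J0 u \<in> V"
    using V u by (auto simp: special_plane_def)
  have ne: "J0 u \<noteq> c *\<^sub>R u" for c
  proof
    assume c: "J0 u = c *\<^sub>R u"
    have "J0 (c *\<^sub>R u) = c *\<^sub>R J0 u" by (simp add: J0_def algebra_simps)
    then have "- u = (c * c) *\<^sub>R u" using J0_J0[of u] c by simp
    then have "(c * c + 1) *\<^sub>R u = 0" by (simp add: scaleR_left_distrib flip: \<open>- u = _\<close>)
    moreover have "c * c + 1 \<noteq> 0" by (smt (verit) zero_le_square)
    ultimately show False using u(2) by simp
  qed
  then have indep: "independent {u, J0 u}"
    using u(2) ne[of 1]
    by (subst insert_commute) (auto simp: independent_insert span_singleton)
  have "u \<noteq> J0 u" using ne[of 1] by auto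
  then have "V \<subseteq> span {u, J0 u}"
    using indep u(1) \<open>J0 u \<in> V\<close> \<open>dim V = 2\<close> by (intro card_ge_dim_independent) auto
  moreover have "span {u, J0 u} \<subseteq> V"
    using u(1) \<open>J0 u \<in> V\<close> \<open>subspace V\<close> by (intro span_minimal) auto
  ultimately show ?thesis by blast
qed

lemma special_plane_elements:
  assumes V: "special_plane V" and u: "u \<in> V" "u \<noteq> 0" and v: "v \<in> V"
  obtains x y where "v = x *\<^sub>R u + y *\<^sub>R J0 u"
proof -
  have "v \<in> span {u, J0 u}" using special_plane_span[OF V u] v by simp
  then obtain x y where "v - x *\<^sub>R u = y *\<^sub>R J0 u"
    by (auto simp: span_breakdown_eq span_singleton)
  then have "v = x *\<^sub>R u + y *\<^sub>R J0 u" by (metis add.commute diff_add_cancel)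
  then show ?thesis by (rule that)
qed

text \<open>Since \<open>u\<close> and \<open>J0 u\<close> are orthogonal and span the plane, a null vector \<open>u\<close> would be orthogonal to
  all of it.\<close>

lemma special_plane_metric_nonzero:
  assumes V: "special_plane V" and u: "u \<in> V" "u \<noteq> 0"
  shows "metric0 u u \<noteq> 0"
proof
  assume 0: "metric0 u u = 0"
  have "metric0 u v = 0" if "v \<in> V" for v
    using special_plane_elements[OF V u that] 0 metric0_J0
    by (metis add_0 metric0_linear(4,6) mult_zero_right)
  then show False using V u by (auto simp: special_plane_def)
qed

text \<open>Both equations between lengths come from the orthogonality of the exchanged vector \<open>(\<beta>, \<alpha>)\<close>
  to \<open>u = (\<alpha>, \<beta>)\<close> and to \<open>J0 u\<close>.\<close>

lemma special_plane_lengths: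
  assumes V: "special_plane V" and u: "u \<in> V"
  shows "trace_form (snd u) (snd u) = trace_form (fst u) (fst u)"
    and "2 * trace_form (fst u) (snd u) = trace_form (fst u) (fst u)"
    and "metric0 u u = trace_form (fst u) (fst u)"
proof -
  obtain \<alpha> \<beta> where \<alpha>\<beta>: "u = (\<alpha>, \<beta>)" by force
  have "J0 u \<in> V" using V u by (auto simp: special_plane_def)
  then have "metric0 (prod.swap u) u = 0" and "metric0 (prod.swap u) (J0 u) = 0"
    using V u unfolding special_plane_def by blast+
  then have "metric0 (\<beta>, \<alpha>) (\<alpha>, \<beta>) = 0" and "metric0 (\<beta>, \<alpha>) (\<alpha> - 2 *\<^sub>R \<beta>, 2 *\<^sub>R \<alpha> - \<beta>) = 0"
    by (simp_all add: \<alpha>\<beta> J0_def metric0_linear(6) del: scaleR_Pair)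
  then show "trace_form (snd u) (snd u) = trace_form (fst u) (fst u)"
    "2 * trace_form (fst u) (snd u) = trace_form (fst u) (fst u)"
    "metric0 u u = trace_form (fst u) (fst u)"
    by (simp_all add: \<alpha>\<beta> metric0_def tf.diff_right tf.scaleR_right trace_form_sym[of \<beta> \<alpha>])
qed

text \<open>By the lengths above and the Clifford relation, \<open>\<rho> = \<beta> \<alpha> / \<langle>\<alpha>,\<alpha>\<rangle>\<close> works for a single nonzero
  vector \<open>u = (\<alpha>, \<beta>)\<close> of the plane; both rules are linear and hold for \<open>J0 u\<close> as well.\<close>

lemma special_plane_turn:
  assumes V: "special_plane V"
  shows "\<exists>\<rho>. is_turn \<rho> V"
proof -
  have "V \<noteq> {0}" using V by (auto simp: special_plane_def)
  moreover have "0 \<in> V" using V by (auto simp: special_plane_def subspace_0)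
  ultimately obtain u where u: "u \<in> V" "u \<noteq> 0" by blast
  obtain \<alpha> \<beta> where \<alpha>\<beta>: "u = (\<alpha>, \<beta>)" by force
  define s where "s = trace_form \<alpha> \<alpha>"
  have sl: "\<alpha> \<in> sl2" "\<beta> \<in> sl2" using u V by (auto simp: \<alpha>\<beta> special_plane_def)
  have s: "s \<noteq> 0" "trace_form \<beta> \<beta> = s" "2 * trace_form \<alpha> \<beta> = s"
    using special_plane_lengths[OF V u(1)] special_plane_metric_nonzero[OF V u] by (auto simp: \<alpha>\<beta> s_def)
  have \<alpha>2: "\<alpha> ** \<alpha> = s *\<^sub>R mat 1" and \<beta>2: "\<beta> ** \<beta> = s *\<^sub>R mat 1"
    using square_in_sl2 sl s s_def by auto
  have anti: "\<alpha> ** \<beta> = s *\<^sub>R mat 1 - \<beta> ** \<alpha>"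
    using clifford_relation[OF sl] s by (simp add: algebra_simps)
  have \<alpha>2': "\<alpha> ** (\<alpha> ** X) = s *\<^sub>R X" and \<beta>2': "\<beta> ** (\<beta> ** X) = s *\<^sub>R X"
    and anti': "\<alpha> ** (\<beta> ** X) = s *\<^sub>R X - \<beta> ** (\<alpha> ** X)" for X :: mat2
    using \<alpha>2 \<beta>2 anti by (simp_all add: matrix_mul_assoc mm.scaleR_left mm.diff_left)
  define \<rho> where "\<rho> = (1 / s) *\<^sub>R (\<beta> ** \<alpha>)"
  note rew = mm_expand \<alpha>2 \<beta>2 anti \<alpha>2' \<beta>2' anti'
  have 1: "\<rho> ** \<alpha> = \<beta>" "\<rho> ** \<beta> = \<beta> - \<alpha>" "\<alpha> ** \<rho> = \<alpha> - \<beta>" "\<beta> ** \<rho> = \<alpha>"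
    using s(1) by (simp_all add: \<rho>_def rew scaleR_diff_right)
  have "trace \<rho> = 1"
  proof -
    have "trace \<rho> = (1 / s) * trace (\<beta> ** \<alpha>)"
      by (simp add: \<rho>_def linear_cmul[OF bounded_linear.linear[OF bounded_linear_trace]] del: times_divide_eq_left)
    also have "trace (\<beta> ** \<alpha>) = 2 * trace_form \<alpha> \<beta>"
      by (simp add: trace_form_def trace_mul_sym[of \<beta>])
    finally show ?thesis using s by simp
  qed
  moreover have "det \<rho> = 1"
  proof -
    have "det \<gamma> = - trace_form \<gamma> \<gamma>" if "\<gamma> \<in> sl2" for \<gamma>
    proof -
      have "\<gamma> $ 2 $ 2 = - (\<gamma> $ 1 $ 1)" using that by (auto simp: sl2_def mat2_entries)
      then show ?thesis by (simp add: trace_form_def mat2_entries field_simps)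
    qed
    then have "det \<alpha> = - s" "det \<beta> = - s" using sl s by (auto simp: s_def)
    moreover have "det (c *\<^sub>R A) = c\<^sup>2 * det A" for c and A :: mat2
      by (simp add: det_2 power2_eq_square algebra_simps)
    ultimately show ?thesis using s(1) by (simp add: \<rho>_def det_mul power2_eq_square)
  qed
  moreover have "snd v = \<rho> ** fst v \<and> fst v ** \<rho> = fst v - \<rho> ** fst v" if v: "v \<in> V" for v
  proof -
    obtain x y where xy: "v = x *\<^sub>R u + y *\<^sub>R J0 u" by (rule special_plane_elements[OF V u v])
    show ?thesis unfolding xy
      by (simp add: \<alpha>\<beta> J0_def mm_expand 1) (simp add: vec_eq_iff algebra_simps)
  qed
  ultimately show ?thesis by (auto simp: is_turn_def SL2_def)
qed

lemma is_turn_square: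
  assumes "is_turn \<rho> V"
  shows "\<rho> ** \<rho> = \<rho> - mat 1"
  using assms cayley_hamilton_2[of \<rho>] by (simp add: is_turn_def SL2_def)

text \<open>First components of nonzero vectors of the plane are invertible, so one of them determines \<open>\<rho>\<close>.
  The formula also shows that \<open>\<rho>\<close> depends differentiably on the plane.\<close>

lemma is_turn_unique:
  assumes "special_plane V" "is_turn \<rho> V" "u \<in> V" "u \<noteq> 0"
  shows "\<rho> = (1 / trace_form (fst u) (fst u)) *\<^sub>R (snd u ** fst u)"
proof -
  have "trace_form (fst u) (fst u) \<noteq> 0"
    using special_plane_lengths(3) special_plane_metric_nonzero assms by metis
  moreover have "fst u ** fst u = trace_form (fst u) (fst u) *\<^sub>R mat 1"
    using assms by (intro square_in_sl2) (auto simp: special_plane_def)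
  moreover have "snd u = \<rho> ** fst u" using assms by (auto simp: is_turn_def)
  ultimately show ?thesis by (simp add: mm_expand)
qed

text \<open>The algebraic heart of the proof.  Here \<open>u\<close> and \<open>v\<close> are two vectors of the plane and \<open>w\<close> stands for
  the derivative in direction \<open>v\<close> of a field with value \<open>u\<close>; the last hypothesis says that the
  covariant derivative \<open>w + nabla0 v u\<close> stays in the plane.  All words in \<open>\<rho>\<close>, \<open>fst u\<close> and \<open>fst v\<close>
  are brought to a normal form with \<open>\<rho>\<close> on the left and with no power of \<open>\<rho>\<close> above the first.  For
  \<open>\<beta> = \<rho> \<alpha>\<close> along a surface, the conclusion is \<open>(\<alpha>(v) \<rho> + d\<rho>(v)) \<alpha> = 0\<close>.\<close>

lemma turn_structure_equation:
  assumes \<rho>: "\<rho> ** \<rho> = \<rho> - mat 1"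
    and u: "snd u = \<rho> ** fst u" "fst u ** \<rho> = fst u - \<rho> ** fst u"
    and v: "snd v = \<rho> ** fst v" "fst v ** \<rho> = fst v - \<rho> ** fst v"
    and w: "snd (w + nabla0 v u) = \<rho> ** fst (w + nabla0 v u)"
  shows "fst v ** snd u + snd w - \<rho> ** fst w = 0"
proof -
  have \<rho>': "\<rho> ** (\<rho> ** X) = \<rho> ** X - X"
    and u': "fst u ** (\<rho> ** X) = fst u ** X - \<rho> ** (fst u ** X)"
    and v': "fst v ** (\<rho> ** X) = fst v ** X - \<rho> ** (fst v ** X)" for X :: mat2
    using \<rho> u v by (simp_all add: matrix_mul_assoc mm.diff_left)
  have "snd w - \<rho> ** fst w = \<rho> ** fst (nabla0 v u) - snd (nabla0 v u)"
    using w by (simp add: mm.add_right algebra_simps)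
  moreover have "fst v ** snd u + (\<rho> ** fst (nabla0 v u) - snd (nabla0 v u)) = 0"
    unfolding nabla0_def bracket0_def twist0_def commutator_def u(1) v(1)
    by (simp only: fst_scaleR snd_scaleR fst_add snd_add fst_conv snd_conv
        mm_expand \<rho> u v \<rho>' u' v') (simp add: vec_eq_iff field_simps)
  ultimately show ?thesis by (metis add_diff_eq)
qed

section \<open>Structure equations in a chart\<close>

text \<open>The left-trivialized derivative \<open>(A\<^sup>-\<^sup>1 dA, B\<^sup>-\<^sup>1 dB)\<close>.\<close>

definition maurer_cartan :: "(real^2 \<Rightarrow> mpair) \<Rightarrow> real^2 \<Rightarrow> real^2 \<Rightarrow> mpair" where
  "maurer_cartan f x w = lpull (f x) (frechet_derivative f (at x) w)"

definition left_tangent_plane :: "(real^2 \<Rightarrow> mpair) \<Rightarrow> real^2 \<Rightarrow> mpair set" where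
  "left_tangent_plane f x = lpull (f x) ` tangent_plane f x"

text \<open>Chosen from the tangent plane alone, so that charts with the same tangent plane have the same \<open>\<rho>\<close>.\<close>

definition turn :: "(real^2 \<Rightarrow> mpair) \<Rightarrow> real^2 \<Rightarrow> mat2" where
  "turn f x = (SOME \<rho>. is_turn \<rho> (left_tangent_plane f x))"

text \<open>For a surface \<open>(A, B)\<close> this is the pair \<open>(A \<rho>, B \<rho>\<^sup>-\<^sup>1)\<close>, by which a totally geodesic surface is
  a left translate of the model.\<close>

definition left_factor :: "(real^2 \<Rightarrow> mpair) \<Rightarrow> real^2 \<Rightarrow> mpair" where
  "left_factor f x = ltrans (f x) (turn f x, mat 1 - turn f x)"

lemma det_has_derivative:
  fixes A :: "'a::real_normed_vector \<Rightarrow> mat2"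
  assumes "(A has_derivative A') (at x)"
  shows "((\<lambda>y. det (A y)) has_derivative (\<lambda>w. trace (adj2 (A x) ** A' w))) (at x)"
proof -
  have e: "((\<lambda>y. A y $ i $ j) has_derivative (\<lambda>w. A' w $ i $ j)) (at x)" for i j
    using assms by (intro bounded_linear.has_derivative[OF bounded_linear_vec_nth])
  show ?thesis
    unfolding det_2
    by (rule has_derivative_eq_rhs, (rule e derivative_intros)+)
       (simp add: fun_eq_iff adj2_def mat2_entries algebra_simps)
qed

lemma lpull_SLSL: "p \<in> SLSL \<Longrightarrow> lpull p u = (adj2 (fst p) ** fst u, adj2 (snd p) ** snd u)"
  by (auto simp: lpull_def matrix_inv_SL2)

lemma lpull_ltrans_SLSL:
  assumes "p \<in> SLSL"
  shows "lpull p (ltrans p \<xi>) = \<xi>" "ltrans p (lpull p \<xi>) = \<xi>"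
  using assms SLSL_det[OF assms] by (simp_all add: lpull_ltrans)

lemma linear_lpull: "linear (lpull p)"
  by (simp add: linear_iff lpull_def mm_expand)

lemma J_ltrans: "p \<in> SLSL \<Longrightarrow> J p (ltrans p \<xi>) = ltrans p (J0 \<xi>)"
  by (simp add: J_def J0_def lpull_ltrans_SLSL split_def Let_def ltrans.scaleR_right del: scaleR_Pair)

lemma P_ltrans: "p \<in> SLSL \<Longrightarrow> P p (ltrans p \<xi>) = ltrans p (prod.swap \<xi>)"
  by (simp add: P_def lpull_ltrans_SLSL split_def Let_def prod.swap_def)

text \<open>The coordinate expression \<open>f\<close> of the immersion in one chart with coordinate domain \<open>S\<close>.\<close>

locale surface_patch =
  fixes D :: "mpair \<Rightarrow> mpair \<Rightarrow> (mpair \<Rightarrow> mpair) \<Rightarrow> mpair" and f :: "real^2 \<Rightarrow> mpair" and S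
  assumes levi_civita: "levi_civita D"
    and open_domain: "open S"
    and values_in: "\<And>x. x \<in> S \<Longrightarrow> f x \<in> SLSL"
    and smooth: "smooth_on S f"
    and immersive: "\<And>x. x \<in> S \<Longrightarrow> inj (frechet_derivative f (at x))"
    and complex: "\<And>x. x \<in> S \<Longrightarrow> J (f x) ` tangent_plane f x \<subseteq> tangent_plane f x"
    and regular: "\<And>x u. x \<in> S \<Longrightarrow> u \<in> tangent_plane f x \<Longrightarrow>
      (\<And>v. v \<in> tangent_plane f x \<Longrightarrow> g (f x) u v = 0) \<Longrightarrow> u = 0"
    and geodesic: "\<And>x v w. x \<in> S \<Longrightarrow> second_fundamental_form D f x v w = 0"
    and P_normal: "\<And>x. x \<in> S \<Longrightarrow> P (f x) ` tangent_plane f x \<subseteq> normal_space f x"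
begin

abbreviation "df x \<equiv> frechet_derivative f (at x)"
abbreviation "\<mu> \<equiv> maurer_cartan f"

lemma differentiable: "x \<in> S \<Longrightarrow> f differentiable at x"
  using smooth[unfolded smooth_on_def, rule_format, of "Suc 0"] by simp

lemma has_derivative: "x \<in> S \<Longrightarrow> (f has_derivative df x) (at x)"
  using differentiable frechet_derivative_works by blast

lemma derivative_differentiable: "x \<in> S \<Longrightarrow> (\<lambda>y. df y w) differentiable at x"
  using smooth[unfolded smooth_on_def, rule_format, of "Suc (Suc 0)"] by simp

lemma inv: assumes "x \<in> S" shows "det (fst (f x)) = 1" "det (snd (f x)) = 1"
  using SLSL_det[OF values_in[OF assms]] by auto

lemma df_eq: "x \<in> S \<Longrightarrow> df x w = ltrans (f x) (\<mu> x w)"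
  by (simp add: maurer_cartan_def lpull_ltrans_SLSL values_in)

text \<open>Differentiating the equation \<open>det A = 1\<close> shows that \<open>A\<^sup>-\<^sup>1 dA\<close> has trace zero.\<close>

lemma \<mu>_in: assumes x: "x \<in> S" shows "\<mu> x w \<in> sl2 \<times> sl2"
proof -
  have *: "trace (adj2 (A x) ** A' w) = 0"
    if A: "(A has_derivative A') (at x)" and A1: "\<And>y. y \<in> S \<Longrightarrow> det (A y) = 1" for A :: "real^2 \<Rightarrow> mat2" and A'
  proof -
    have "((\<lambda>y. det (A y)) has_derivative (\<lambda>w. 0)) (at x)"
      by (rule has_derivative_transform_within_open[OF has_derivative_const[of 1] open_domain x])
        (simp add: A1)
    then show ?thesis
      by (rule fun_cong[OF has_derivative_unique[OF det_has_derivative[OF A]]])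
  qed
  show ?thesis
    using *[OF has_derivative_fst[OF has_derivative[OF x]]] *[OF has_derivative_snd[OF has_derivative[OF x]]] inv
    by (simp add: maurer_cartan_def lpull_SLSL values_in x sl2_def)
qed

lemma linear_\<mu>: assumes x: "x \<in> S" shows "linear (\<mu> x)"
  using linear_compose[OF has_derivative_linear[OF has_derivative[OF x]] linear_lpull[of "f x"]]
  by (simp add: maurer_cartan_def[abs_def] o_def)

lemma inj_\<mu>: assumes x: "x \<in> S" shows "inj (\<mu> x)"
  using immersive[OF x] df_eq[OF x] by (simp add: inj_def)

lemma left_tangent_plane_eq: "left_tangent_plane f x = range (\<mu> x)"
  by (auto simp: left_tangent_plane_def tangent_plane_def maurer_cartan_def)

lemma tangent_plane_eq: "x \<in> S \<Longrightarrow> tangent_plane f x = ltrans (f x) ` range (\<mu> x)"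
  by (auto simp: tangent_plane_def df_eq)

lemma ltrans_cancel:
  assumes "x \<in> S" shows "ltrans (f x) \<xi> = ltrans (f x) \<eta> \<longleftrightarrow> \<xi> = \<eta>"
  using lpull_ltrans_SLSL(1)[OF values_in[OF assms]] by metis

lemma ltrans_in_tangent:
  assumes "x \<in> S" shows "ltrans (f x) \<xi> \<in> tangent_plane f x \<longleftrightarrow> \<xi> \<in> range (\<mu> x)"
  by (simp add: tangent_plane_eq assms image_iff ltrans_cancel)

lemma g_ltrans: "x \<in> S \<Longrightarrow> g (f x) (ltrans (f x) \<xi>) (ltrans (f x) \<eta>) = metric0 \<xi> \<eta>"
  by (simp add: g_eq_metric0 lpull_ltrans_SLSL values_in)

lemma ltrans_in_normal:
  assumes "x \<in> S"
  shows "ltrans (f x) \<xi> \<in> normal_space f x \<longleftrightarrow>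
    \<xi> \<in> sl2 \<times> sl2 \<and> (\<forall>u\<in>range (\<mu> x). metric0 \<xi> u = 0)"
proof -
  have "ltrans (f x) \<xi> \<in> tangent_SLSL (f x) \<longleftrightarrow> \<xi> \<in> sl2 \<times> sl2"
    by (simp add: tangent_SLSL_def image_iff ltrans_cancel[OF assms] Bex_def del: mem_Sigma_iff split_paired_Ex)
  then show ?thesis
    by (auto simp: normal_space_def tangent_plane_eq assms g_ltrans)
qed

lemma special_plane_\<mu>:
  assumes x: "x \<in> S" shows "special_plane (range (\<mu> x))"
  unfolding special_plane_def
proof (intro conjI ballI impI)
  show "subspace (range (\<mu> x))"
    by (rule subspace_UNIV[THEN linear_subspace_image[OF linear_\<mu>[OF x]]])
  have "dim (range (\<mu> x)) = dim (UNIV :: (real^2) set)"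
    using linear_\<mu>[OF x] inj_\<mu>[OF x] by (intro dim_image_eq) auto
  then show "dim (range (\<mu> x)) = 2" by simp
  show "range (\<mu> x) \<subseteq> sl2 \<times> sl2" using \<mu>_in[OF x] by blast
  show "J0 ` range (\<mu> x) \<subseteq> range (\<mu> x)"
  proof
    fix v assume "v \<in> J0 ` range (\<mu> x)"
    then obtain u where u: "u \<in> range (\<mu> x)" "v = J0 u" by blast
    then have "J (f x) (ltrans (f x) u) \<in> tangent_plane f x"
      using complex[OF x] ltrans_in_tangent[OF x] by blast
    then show "v \<in> range (\<mu> x)"
      by (simp add: J_ltrans values_in x u(2) ltrans_in_tangent)
  qed
  fix u assume u: "u \<in> range (\<mu> x)"
  then have "P (f x) (ltrans (f x) u) \<in> normal_space f x"
    using P_normal[OF x] ltrans_in_tangent[OF x] by blast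
  then show "metric0 (prod.swap u) v = 0" if "v \<in> range (\<mu> x)" for v
    using that unfolding P_ltrans[OF values_in[OF x]] ltrans_in_normal[OF x] by blast
  assume 0: "\<forall>v\<in>range (\<mu> x). metric0 u v = 0"
  have "ltrans (f x) u = 0"
  proof (rule regular[OF x])
    show "ltrans (f x) u \<in> tangent_plane f x" using u by (simp add: ltrans_in_tangent x)
    show "g (f x) (ltrans (f x) u) v = 0" if "v \<in> tangent_plane f x" for v
      using that 0 by (auto simp: tangent_plane_eq x g_ltrans)
  qed
  then show "u = 0" using ltrans_cancel[OF x, of u 0] by (simp add: ltrans.zero_right)
qed

lemma \<mu>_differentiable:
  assumes x: "x \<in> S" shows "(\<lambda>y. \<mu> y w) differentiable at x"
proof -
  obtain d where d: "((\<lambda>y. df y w) has_derivative d) (at x)"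
    using derivative_differentiable[OF x] by (auto simp: differentiable_def)
  note fx = has_derivative[OF x]
  have 1: "((\<lambda>y. adj2 (fst (f y)) ** fst (df y w)) has_derivative
      (\<lambda>h. adj2 (fst (f x)) ** fst (d h) + adj2 (fst (df x h)) ** fst (df x w))) (at x)"
    by (intro mm.FDERIV bounded_linear.has_derivative[OF bounded_linear_adj2] has_derivative_fst fx d)
  have 2: "((\<lambda>y. adj2 (snd (f y)) ** snd (df y w)) has_derivative
      (\<lambda>h. adj2 (snd (f x)) ** snd (d h) + adj2 (snd (df x h)) ** snd (df x w))) (at x)"
    by (intro mm.FDERIV bounded_linear.has_derivative[OF bounded_linear_adj2] has_derivative_snd fx d)
  have "((\<lambda>y. \<mu> y w) has_derivative (\<lambda>h. (adj2 (fst (f x)) ** fst (d h) + adj2 (fst (df x h)) ** fst (df x w),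
      adj2 (snd (f x)) ** snd (d h) + adj2 (snd (df x h)) ** snd (df x w)))) (at x)"
    by (rule has_derivative_transform_within_open[OF has_derivative_Pair[OF 1 2] open_domain x])
      (simp add: maurer_cartan_def lpull_SLSL values_in)
  then show ?thesis by (auto simp: differentiable_def)
qed

lemma derivative_of_sl2_valued:
  assumes x: "x \<in> S" and W: "(W has_derivative W') (at x)" "\<And>y. y \<in> S \<Longrightarrow> W y \<in> sl2 \<times> sl2"
  shows "W' v \<in> sl2 \<times> sl2"
proof -
  have *: "trace (A' v) = 0"
    if A: "(A has_derivative A') (at x)" and A1: "\<And>y. y \<in> S \<Longrightarrow> trace (A y) = 0" for A :: "real^2 \<Rightarrow> mat2" and A'
  proof -
    have "((\<lambda>y. trace (A y)) has_derivative (\<lambda>w. 0)) (at x)"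
      by (rule has_derivative_transform_within_open[OF has_derivative_const[of 0] open_domain x])
        (simp add: A1)
    then show ?thesis
      by (rule fun_cong[OF has_derivative_unique[OF bounded_linear.has_derivative[OF bounded_linear_trace A]]])
  qed
  have "\<And>y. y \<in> S \<Longrightarrow> trace (fst (W y)) = 0" "\<And>y. y \<in> S \<Longrightarrow> trace (snd (W y)) = 0"
    using W(2) by (auto simp: sl2_def mem_Times_iff)
  then show ?thesis
    using *[OF has_derivative_fst[OF W(1)]] *[OF has_derivative_snd[OF W(1)]]
    by (simp add: sl2_def mem_Times_iff)
qed

text \<open>The second fundamental form is defined by a description, so its vanishing carries information
  only once the normal part of the covariant derivative is known to exist and to be unique.  It
  exists by orthogonal projection along the basis \<open>u\<close>, \<open>J0 u\<close> and is unique because the metric is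
  non-degenerate on the plane.  Then the covariant derivative, here in left-trivialized form, is
  its own tangential part.\<close>

lemma geodesic_equation:
  assumes x: "x \<in> S"
  shows "frechet_derivative (\<lambda>y. \<mu> y w) (at x) v + nabla0 (\<mu> x v) (\<mu> x w) \<in> range (\<mu> x)"
    (is "?c \<in> ?V")
proof -
  note V = special_plane_\<mu>[OF x]
  have "((\<lambda>y. \<mu> y w) has_derivative frechet_derivative (\<lambda>y. \<mu> y w) (at x)) (at x)"
    using \<mu>_differentiable[OF x] by (simp only: frechet_derivative_works)
  from derivative_of_sl2_valued[OF x this \<mu>_in, of v]
  have c_in: "?c \<in> sl2 \<times> sl2"
    using nabla0_in[of "\<mu> x v" "\<mu> x w"] by (simp add: mem_Times_iff sl2_closed(1))
  have cov: "cov_along D f x v (\<lambda>y. df y w) = ltrans (f x) ?c"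
    using levi_civita_left_invariant[OF levi_civita values_in[OF x] \<mu>_in[OF x] \<mu>_in[OF x]]
    by (simp add: cov_along_def df_eq[OF x, of v] ltrans.add_right flip: maurer_cartan_def)
  let ?Q = "\<lambda>n. n \<in> normal_space f x \<and> ltrans (f x) ?c - n \<in> tangent_plane f x"
  obtain w0 :: "real^2" where "w0 \<noteq> 0" using axis_eq_0_iff[of 1 "1::real"] by (metis zero_neq_one)
  define u where "u = \<mu> x w0"
  have u: "u \<in> ?V" "u \<noteq> 0"
    using \<open>w0 \<noteq> 0\<close> inj_\<mu>[OF x] linear_\<mu>[OF x] by (auto simp: u_def linear_injective_0)
  have Ju: "J0 u \<in> ?V" using V u by (auto simp: special_plane_def)
  \<comment> \<open>The orthogonal projection of the covariant derivative to the plane; \<open>u\<close> and \<open>J0 u\<close> are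
    orthogonal and of equal length.\<close>
  define t where "t = (metric0 ?c u / metric0 u u) *\<^sub>R u + (metric0 ?c (J0 u) / metric0 u u) *\<^sub>R J0 u"
  have t: "t \<in> ?V"
    using V u Ju by (auto simp: t_def special_plane_def subspace_add subspace_scale)
  have perp: "metric0 (?c - t) z = 0" if z: "z \<in> ?V" for z
  proof -
    obtain r s where rs: "z = r *\<^sub>R u + s *\<^sub>R J0 u" by (rule special_plane_elements[OF V u z])
    have "metric0 (?c - t) u = 0" "metric0 (?c - t) (J0 u) = 0"
      using special_plane_metric_nonzero[OF V u]
      by (simp_all add: t_def metric0_linear metric0_J0 metric0_J0(1)[unfolded metric0_sym[of _ "J0 _"]])
    then show ?thesis by (simp add: rs metric0_linear)
  qed
  have t_in: "t \<in> sl2 \<times> sl2" using t V by (auto simp: special_plane_def)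
  have n: "?Q (ltrans (f x) (?c - t))"
    using perp t c_in t_in
    by (auto simp: ltrans_in_normal x ltrans_in_tangent mem_Times_iff sl2_closed simp flip: ltrans.diff_right)
  have "n = n'" if "?Q n" "?Q n'" for n n'
  proof -
    have sub: "subspace (tangent_plane f x)"
      unfolding tangent_plane_def
      by (rule subspace_UNIV[THEN linear_subspace_image[OF has_derivative_linear[OF has_derivative[OF x]]]])
    have d: "n - n' \<in> tangent_plane f x"
      using subspace_diff[OF sub that(2)[THEN conjunct2] that(1)[THEN conjunct2]] by simp
    moreover have "g (f x) (n - n') z = 0" if "z \<in> tangent_plane f x" for z
      using that \<open>?Q n\<close> \<open>?Q n'\<close> linear_diff[OF linear_lpull]
      by (simp add: normal_space_def g_eq_metric0 metric0_linear)
    ultimately show ?thesis using regular[OF x d] by simp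
  qed
  then have "?Q (THE n. ?Q n)" using n theI[of ?Q] by blast
  moreover have "(THE n. ?Q n) = 0"
    using geodesic[OF x, of v w] by (simp add: second_fundamental_form_def cov)
  ultimately show ?thesis by (simp add: ltrans_in_tangent x)
qed

lemma is_turn_turn: "x \<in> S \<Longrightarrow> is_turn (turn f x) (range (\<mu> x))"
  using someI_ex[OF special_plane_turn[OF special_plane_\<mu>]] by (simp add: turn_def left_tangent_plane_eq)

lemma turned:
  assumes "x \<in> S"
  shows "snd (\<mu> x v) = turn f x ** fst (\<mu> x v)"
    and "fst (\<mu> x v) ** turn f x = fst (\<mu> x v) - turn f x ** fst (\<mu> x v)"
  using is_turn_turn[OF assms] by (auto simp: is_turn_def)

lemma turn_square: "x \<in> S \<Longrightarrow> turn f x ** turn f x = turn f x - mat 1"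
  using is_turn_square[OF is_turn_turn] .

text \<open>With \<open>(\<alpha>, \<beta>) = maurer_cartan f\<close>, the relation \<open>\<beta> = \<rho> \<alpha>\<close> is differentiated and compared with the structure
  equation; the remaining factor \<open>\<alpha>\<close> on the right is invertible and can be cancelled.\<close>

lemma turn_derivative:
  assumes x: "x \<in> S"
  shows "(turn f has_derivative (\<lambda>v. - (fst (\<mu> x v) ** turn f x))) (at x)"
proof -
  \<comment> \<open>Any constant nonzero coordinate vector serves to express \<open>\<rho>\<close> through \<open>\<mu>\<close>.\<close>
  define w :: "real^2" where "w = axis 1 1"
  have w: "w \<noteq> 0" by (simp add: w_def axis_eq_0_iff)
  define \<rho> where "\<rho> = turn f"
  define \<mu>' where "\<mu>' = frechet_derivative (\<lambda>y. \<mu> y w) (at x)"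
  have \<mu>': "((\<lambda>y. \<mu> y w) has_derivative \<mu>') (at x)"
    using \<mu>_differentiable[OF x, of w] frechet_derivative_works \<mu>'_def by metis
  note a' = has_derivative_fst[OF \<mu>'] and b' = has_derivative_snd[OF \<mu>']
  have nz: "\<mu> y w \<noteq> 0" if "y \<in> S" for y
    using w inj_\<mu>[OF that] linear_\<mu>[OF that] by (auto simp: linear_injective_0)
  have \<rho>_eq: "\<rho> y = (1 / trace_form (fst (\<mu> y w)) (fst (\<mu> y w))) *\<^sub>R (snd (\<mu> y w) ** fst (\<mu> y w))"
    if y: "y \<in> S" for y
    unfolding \<rho>_def using special_plane_\<mu>[OF y] is_turn_turn[OF y] _ nz[OF y] by (rule is_turn_unique) simp
  define a where "a = fst (\<mu> x w)"
  have a_nz: "trace_form a a \<noteq> 0"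
    using special_plane_\<mu>[OF x] nz[OF x] special_plane_lengths(3) special_plane_metric_nonzero
    unfolding a_def by (metis rangeI)
  obtain \<rho>' where \<rho>': "(\<rho> has_derivative \<rho>') (at x)"
  proof -
    have "((\<lambda>y. (1 / trace_form (fst (\<mu> y w)) (fst (\<mu> y w))) *\<^sub>R (snd (\<mu> y w) ** fst (\<mu> y w))) differentiable at x)"
      unfolding differentiable_def
      using a_nz[unfolded a_def]
      by (intro exI) (rule has_derivative_scaleR has_derivative_divide' has_derivative_const mm.FDERIV tf.FDERIV a' b' | assumption)+
    then obtain d where "((\<lambda>y. (1 / trace_form (fst (\<mu> y w)) (fst (\<mu> y w))) *\<^sub>R (snd (\<mu> y w) ** fst (\<mu> y w))) has_derivative d) (at x)"
      by (auto simp: differentiable_def)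
    from has_derivative_transform_within_open[OF this open_domain x] show thesis
      by (rule that) (simp add: \<rho>_eq)
  qed
  have \<rho>'_eq: "\<rho>' v = - (fst (\<mu> x v) ** \<rho> x)" for v
  proof -
    have "((\<lambda>y. \<rho> y ** fst (\<mu> y w)) has_derivative (\<lambda>v. \<rho> x ** fst (\<mu>' v) + \<rho>' v ** a)) (at x)"
      unfolding a_def by (intro mm.FDERIV \<rho>' a')
    then have "((\<lambda>y. snd (\<mu> y w)) has_derivative (\<lambda>v. \<rho> x ** fst (\<mu>' v) + \<rho>' v ** a)) (at x)"
      by (rule has_derivative_transform_within_open[OF _ open_domain x])
        (use is_turn_turn in \<open>auto simp: is_turn_def \<rho>_def\<close>)
    then have "snd (\<mu>' v) = \<rho> x ** fst (\<mu>' v) + \<rho>' v ** a"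
      by (rule fun_cong[OF has_derivative_unique[OF b']])
    moreover have "fst (\<mu> x v) ** snd (\<mu> x w) + snd (\<mu>' v) - \<rho> x ** fst (\<mu>' v) = 0"
    proof -
      have "snd (\<mu>' v + nabla0 (\<mu> x v) (\<mu> x w)) = turn f x ** fst (\<mu>' v + nabla0 (\<mu> x v) (\<mu> x w))"
        using geodesic_equation[OF x, of w v] is_turn_turn[OF x] unfolding \<mu>'_def is_turn_def by blast
      then show ?thesis
        unfolding \<rho>_def by (rule turn_structure_equation[OF turn_square[OF x] turned[OF x] turned[OF x]])
    qed
    moreover have "snd (\<mu> x w) = \<rho> x ** a" using turned(1)[OF x, of w] by (simp add: a_def \<rho>_def)
    ultimately have "(fst (\<mu> x v) ** \<rho> x + \<rho>' v) ** a = 0" by (simp add: mm_expand)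
    then have "(fst (\<mu> x v) ** \<rho> x + \<rho>' v) ** (a ** a) = 0" by (simp add: matrix_mul_assoc)
    moreover have "a ** a = trace_form a a *\<^sub>R mat 1"
      using \<mu>_in[OF x, of w] by (intro square_in_sl2) (auto simp: a_def mem_Times_iff)
    ultimately have "fst (\<mu> x v) ** \<rho> x + \<rho>' v = 0" using a_nz by (simp add: mm_expand)
    then show ?thesis by (simp add: eq_neg_iff_add_eq_0 add.commute)
  qed
  show ?thesis
    using \<rho>' by (simp add: \<rho>'_eq[THEN ext] flip: \<rho>_def)
qed

text \<open>Since \<open>dA = A \<alpha>\<close>, the equation for \<open>d\<rho>\<close> says \<open>d(A \<rho>) = 0\<close>.  Similarly
  \<open>d(B (1 - \<rho>)) = B (\<rho> \<alpha> (1 - \<rho>) + \<alpha> \<rho>)\<close>, and \<open>\<rho> \<alpha> (1 - \<rho>) = \<rho>\<^sup>2 \<alpha> = - \<alpha> \<rho>\<close>.\<close>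

lemma left_factor_derivative:
  assumes x: "x \<in> S"
  shows "(left_factor f has_derivative (\<lambda>v. 0)) (at x)"
proof -
  let ?\<rho> = "turn f" and ?\<rho>' = "\<lambda>v. - (fst (\<mu> x v) ** turn f x)"
  have "((\<lambda>y. ltrans (f y) (?\<rho> y, mat 1 - ?\<rho> y)) has_derivative
      (\<lambda>v. ltrans (f x) (?\<rho>' v, 0 - ?\<rho>' v) + ltrans (df x v) (?\<rho> x, mat 1 - ?\<rho> x))) (at x)"
    by (intro ltrans.FDERIV has_derivative[OF x] has_derivative_Pair turn_derivative[OF x]
        has_derivative_diff has_derivative_const)
  moreover have "ltrans (f x) (?\<rho>' v, 0 - ?\<rho>' v) + ltrans (df x v) (?\<rho> x, mat 1 - ?\<rho> x) = 0" for v
  proof -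
    have "ltrans (df x v) (?\<rho> x, mat 1 - ?\<rho> x)
        = ltrans (f x) (fst (\<mu> x v) ** ?\<rho> x, snd (\<mu> x v) ** (mat 1 - ?\<rho> x))"
      by (simp add: df_eq[OF x] ltrans_def matrix_mul_assoc)
    moreover have "snd (\<mu> x v) ** (mat 1 - ?\<rho> x) = - (fst (\<mu> x v) ** ?\<rho> x)"
    proof -
      have "?\<rho> x ** (?\<rho> x ** X) = ?\<rho> x ** X - X" for X :: mat2
        using turn_square[OF x] by (simp add: matrix_mul_assoc mm.diff_left)
      then show ?thesis
        using turned[OF x, of v] by (simp add: mm_expand)
    qed
    ultimately show ?thesis
      by (simp add: ltrans.zero_right flip: ltrans.add_right zero_prod_def)
  qed
  ultimately show ?thesis by (simp add: left_factor_def[abs_def])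
qed

end

section \<open>The model surface\<close>

lemma mat2_eqI:
  fixes A B :: mat2
  shows "A$1$1 = B$1$1 \<Longrightarrow> A$1$2 = B$1$2 \<Longrightarrow> A$2$1 = B$2$1 \<Longrightarrow> A$2$2 = B$2$2 \<Longrightarrow> A = B"
  by (simp add: vec_eq_iff forall_2)

text \<open>With \<open>Y\<close> the trace-zero matrix of \<open>(y1, y2, y3)\<close>, the first matrix of the model is
  \<open>(1 + sqrt 3 Y) / 2\<close> and the second is \<open>(1 - sqrt 3 Y) / 2\<close>.  Every matrix of trace \<open>1\<close> is of the
  latter form, and its determinant is \<open>1\<close> exactly on the quadric.\<close>

lemma model_surface_eq: "model_surface = {(mat 1 - \<rho>, \<rho>) | \<rho>. \<rho> \<in> SL2 \<and> trace \<rho> = 1}"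
proof (intro set_eqI iffI)
  fix p assume "p \<in> model_surface"
  then obtain y1 y2 y3 where p: "p = (model_A y1 y2 y3, model_B y1 y2 y3)" and y: "y1\<^sup>2 + y2\<^sup>2 - y3\<^sup>2 = -1"
    by (auto simp: model_surface_def)
  have "det (model_B y1 y2 y3) = 1/4 - 3/4 * (y1\<^sup>2 + y2\<^sup>2 - y3\<^sup>2)"
    by (simp add: det_2 model_B_def power2_eq_square field_simps)
  then have "model_B y1 y2 y3 \<in> SL2" by (simp add: SL2_def y)
  moreover have "trace (model_B y1 y2 y3) = 1" by (simp add: trace_def sum_2 model_B_def)
  moreover have "model_A y1 y2 y3 = mat 1 - model_B y1 y2 y3"
    by (rule mat2_eqI) (simp_all add: model_A_def model_B_def mat_def)
  ultimately show "p \<in> {(mat 1 - \<rho>, \<rho>) | \<rho>. \<rho> \<in> SL2 \<and> trace \<rho> = 1}" using p by blast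
next
  fix p assume "p \<in> {(mat 1 - \<rho>, \<rho>) | \<rho>. \<rho> \<in> SL2 \<and> trace \<rho> = 1}"
  then obtain \<rho> where p: "p = (mat 1 - \<rho>, \<rho>)" and \<rho>: "det \<rho> = 1" "trace \<rho> = 1" by (auto simp: SL2_def)
  have \<rho>22: "\<rho>$2$2 = 1 - \<rho>$1$1" using \<rho>(2) by (simp add: trace_def sum_2)
  define y1 where "y1 = (1 - 2 * \<rho>$1$1) / sqrt 3"
  define y2 where "y2 = - (\<rho>$1$2 + \<rho>$2$1) / sqrt 3"
  define y3 where "y3 = (\<rho>$2$1 - \<rho>$1$2) / sqrt 3"
  have s: "sqrt 3 * y1 = 1 - 2 * \<rho>$1$1" "sqrt 3 / 2 * (y2 + y3) = - \<rho>$1$2" "sqrt 3 / 2 * (y2 - y3) = - \<rho>$2$1"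
    by (simp_all add: y1_def y2_def y3_def add_divide_distrib[symmetric] diff_divide_distrib[symmetric])
  have B: "model_B y1 y2 y3 = \<rho>"
    by (rule mat2_eqI) (simp_all only: model_B_def vector_2 s, simp_all add: \<rho>22 field_simps)
  have A: "model_A y1 y2 y3 = mat 1 - \<rho>"
    by (rule mat2_eqI) (simp_all only: model_A_def vector_2 s, simp_all add: mat_def \<rho>22 field_simps)
  have "3 * (y1\<^sup>2 + y2\<^sup>2 - y3\<^sup>2) = (1 - 2 * \<rho>$1$1)\<^sup>2 + (\<rho>$1$2 + \<rho>$2$1)\<^sup>2 - (\<rho>$2$1 - \<rho>$1$2)\<^sup>2"
    by (simp add: y1_def y2_def y3_def power_divide distrib_left right_diff_distrib)
      (simp add: power2_eq_square algebra_simps)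
  also have "\<dots> = 1 - 4 * det \<rho>"
    by (simp add: det_2 \<rho>22 power2_eq_square algebra_simps)
  finally have "y1\<^sup>2 + y2\<^sup>2 - y3\<^sup>2 = -1" using \<rho> by simp
  then show "p \<in> model_surface" unfolding model_surface_def p A[symmetric] using B by auto
qed

text \<open>Coordinates on the model surface: up to scaling and translation these are the first two quadric
  coordinates \<open>y1\<close> and \<open>y2\<close>, over which each of the two sheets of the quadric is a graph.\<close>

definition hcoord :: "mat2 \<Rightarrow> real^2" where
  "hcoord \<rho> = vector [\<rho>$1$1, \<rho>$1$2 + \<rho>$2$1]"

text \<open>Up to a factor this is the third quadric coordinate \<open>y3\<close>; its sign tells the two sheets apart.\<close>

definition height :: "mat2 \<Rightarrow> real" where
  "height \<rho> = \<rho>$1$2 - \<rho>$2$1"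

lemma hcoord_eq_iff: "hcoord \<rho> = hcoord \<sigma> \<longleftrightarrow> \<rho>$1$1 = \<sigma>$1$1 \<and> \<rho>$1$2 + \<rho>$2$1 = \<sigma>$1$2 + \<sigma>$2$1"
  by (simp add: hcoord_def vec_eq_iff forall_2)

lemma bounded_linear_hcoord: "bounded_linear hcoord"
  by (rule linear_conv_bounded_linear[THEN iffD1])
     (simp add: linear_iff hcoord_def vec_eq_iff forall_2 algebra_simps)

lemma height_square:
  assumes "\<rho> \<in> SL2" "trace \<rho> = 1"
  shows "(height \<rho>)\<^sup>2 = (1 - 2 * \<rho>$1$1)\<^sup>2 + (\<rho>$1$2 + \<rho>$2$1)\<^sup>2 + 3"
proof -
  have \<rho>22: "\<rho>$2$2 = 1 - \<rho>$1$1" using assms(2) by (simp add: trace_def sum_2)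
  have "\<rho>$1$1 * (1 - \<rho>$1$1) - \<rho>$1$2 * \<rho>$2$1 = 1"
    using assms(1) by (simp add: SL2_def det_2 \<rho>22)
  then show ?thesis
    by (simp add: height_def power2_eq_square algebra_simps)
qed

lemma height_nonzero: "\<rho> \<in> SL2 \<Longrightarrow> trace \<rho> = 1 \<Longrightarrow> height \<rho> \<noteq> 0"
  using height_square[of \<rho>] by (smt (verit) zero_le_power2 zero_eq_power2)

lemma hcoord_height_inject:
  assumes \<rho>: "\<rho> \<in> SL2" "trace \<rho> = 1" and \<sigma>: "\<sigma> \<in> SL2" "trace \<sigma> = 1"
    and eq: "hcoord \<rho> = hcoord \<sigma>" and sgn: "height \<rho> * height \<sigma> > 0"
  shows "\<rho> = \<sigma>"
proof -
  have "(height \<rho>)\<^sup>2 = (height \<sigma>)\<^sup>2"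
    using eq by (simp add: height_square[OF \<rho>] height_square[OF \<sigma>] hcoord_eq_iff)
  then have "height \<rho> = height \<sigma>"
    using sgn by (auto simp: power2_eq_iff)
  then show ?thesis
    using eq \<rho>(2) \<sigma>(2) by (intro mat2_eqI) (auto simp: hcoord_eq_iff height_def trace_def sum_2)
qed

context surface_patch
begin

lemma turn_properties:
  assumes "x \<in> S"
  shows "turn f x \<in> SL2" "trace (turn f x) = 1"
  using is_turn_turn[OF assms] by (auto simp: is_turn_def)

text \<open>A kernel vector \<open>v\<close> fixes the two coordinates to first order.  The derivative of \<open>\<rho>\<close> along \<open>v\<close> is
  tangent to the quadric \<open>trace \<rho> = det \<rho> = 1\<close>, whose height is a function of these coordinates,
  so it vanishes.  By \<open>d\<rho> = - \<alpha> \<rho>\<close> this forces \<open>\<alpha>(v) = 0\<close>, hence \<open>v = 0\<close>.\<close>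

lemma turn_immersive:
  assumes x: "x \<in> S"
  shows "inj (\<lambda>v. hcoord (- (fst (\<mu> x v) ** turn f x)))"
proof -
  let ?\<rho> = "turn f x"
  let ?L = "\<lambda>v. - (fst (\<mu> x v) ** ?\<rho>)"
  have lin: "linear (\<lambda>v. hcoord (?L v))"
    using bounded_linear.has_derivative[OF bounded_linear_hcoord turn_derivative[OF x]]
    by (rule has_derivative_linear)
  have "v = 0" if v: "hcoord (?L v) = 0" for v
  proof -
    define a where "a = fst (\<mu> x v)"
    define R where "R = ?L v"
    have "a \<in> sl2" using \<mu>_in[OF x, of v] by (simp add: a_def mem_Times_iff)
    have tR: "trace R = 0"
    proof -
      have "((\<lambda>y. trace (turn f y)) has_derivative (\<lambda>v. 0)) (at x)"
        by (rule has_derivative_transform_within_open[OF has_derivative_const[of 1] open_domain x])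
          (simp add: turn_properties)
      from has_derivative_unique[OF this bounded_linear.has_derivative[OF bounded_linear_trace turn_derivative[OF x]]]
      show ?thesis unfolding R_def by (rule fun_cong[symmetric])
    qed
    have tadj: "trace (adj2 ?\<rho> ** R) = 0"
    proof -
      have "((\<lambda>y. det (turn f y)) has_derivative (\<lambda>v. 0)) (at x)"
        by (rule has_derivative_transform_within_open[OF has_derivative_const[of 1] open_domain x])
          (use turn_properties in \<open>simp add: SL2_def\<close>)
      from has_derivative_unique[OF this det_has_derivative[OF turn_derivative[OF x]]]
      show ?thesis unfolding R_def by (rule fun_cong[symmetric])
    qed
    have "R$1$1 = 0" "R$1$2 = - (R$2$1)"
      using v by (simp_all add: R_def hcoord_def vec_eq_iff forall_2 eq_neg_iff_add_eq_0)
    moreover have "R$2$2 = 0" using tR \<open>R$1$1 = 0\<close> by (simp add: trace_def sum_2)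
    ultimately have R: "R$1$1 = 0" "R$1$2 = - (R$2$1)" "R$2$2 = 0" by simp_all
    then have "trace (adj2 ?\<rho> ** R) = - (height ?\<rho> * R$2$1)"
      by (simp add: adj2_def mat2_entries height_def algebra_simps)
    with tadj have "height ?\<rho> * R$2$1 = 0" by simp
    then have "R$2$1 = 0" using height_nonzero[OF turn_properties[OF x]] by simp
    with R have "R = 0" by (intro mat2_eqI) simp_all
    then have "a ** ?\<rho> = 0" by (simp add: R_def a_def)
    then have "(a ** ?\<rho>) ** (mat 1 - ?\<rho>) = 0" by simp
    then have "a = 0" using turn_square[OF x] by (simp add: mm_expand)
    then have "\<mu> x v = 0" using turned(1)[OF x, of v] by (simp add: a_def prod_eq_iff)
    then show ?thesis using inj_\<mu>[OF x] linear_\<mu>[OF x] by (simp add: linear_injective_0)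
  qed
  then show ?thesis using lin by (simp add: linear_injective_0)
qed

text \<open>The two coordinates of \<open>\<rho>\<close> form a map between planes with invertible derivative, whose image is
  therefore a neighbourhood; on the sheet selected by the sign of the height they determine the
  point of the model surface.\<close>

lemma turn_open_in_model:
  assumes x: "x \<in> S"
  obtains W where "open W" "(mat 1 - turn f x, turn f x) \<in> W"
    "W \<inter> model_surface \<subseteq> (\<lambda>y. (mat 1 - turn f y, turn f y)) ` S"
proof -
  let ?h = "\<lambda>y. hcoord (turn f y)"
  let ?L = "\<lambda>v. hcoord (- (fst (\<mu> x v) ** turn f x))"
  have cont: "continuous_on S (turn f)"
    using turn_derivative has_derivative_continuous continuous_at_imp_continuous_on by blast
  have der: "(?h has_derivative ?L) (at x)"
    by (intro bounded_linear.has_derivative[OF bounded_linear_hcoord] turn_derivative x)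
  obtain L' where L': "linear L'" "\<forall>v. ?L (L' v) = v"
    using linear_injective_isomorphism[OF has_derivative_linear[OF der] turn_immersive[OF x]] by blast
  have cont_height: "continuous_on UNIV (\<lambda>\<rho>. height \<rho>)"
    unfolding height_def by (intro continuous_intros)
  define T where "T = S \<inter> (\<lambda>y. height (turn f y) * height (turn f x)) -` {0<..}"
  have "open T"
    unfolding T_def
    by (intro continuous_open_preimage open_domain open_greaterThan continuous_on_mult
        continuous_on_compose2[OF cont_height cont] continuous_on_const) auto
  moreover have "x \<in> T"
    using x height_nonzero[OF turn_properties[OF x]] by (auto simp: T_def zero_less_mult_iff linorder_neq_iff)
  ultimately have "x \<in> interior T" by (simp add: interior_open)
  then have in_int: "?h x \<in> interior (?h ` T)"
  proof (rule sussmann_open_mapping[OF open_domain _ x der, rotated -1])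
    show "continuous_on S ?h"
      using continuous_on_compose2[OF linear_continuous_on[OF bounded_linear_hcoord] cont] by blast
    show "bounded_linear L'" using L'(1) by (simp add: linear_conv_bounded_linear)
    show "?L \<circ> L' = id" using L'(2) by (simp add: fun_eq_iff)
  qed (auto simp: T_def)
  define W where "W = {p :: mpair. hcoord (snd p) \<in> interior (?h ` T)} \<inter> {p. height (snd p) * height (turn f x) > 0}"
  have "open W"
    unfolding W_def
  proof (intro open_Int)
    have "continuous_on UNIV (\<lambda>p :: mpair. hcoord (snd p))"
      by (intro continuous_on_compose2[OF linear_continuous_on[OF bounded_linear_hcoord, of UNIV]] continuous_intros) auto
    from open_vimage[OF open_interior this] show "open {p :: mpair. hcoord (snd p) \<in> interior (?h ` T)}"
      by (simp add: vimage_def)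
    show "open {p :: mpair. height (snd p) * height (turn f x) > 0}"
      by (intro open_Collect_less continuous_intros continuous_on_compose2[OF cont_height]) auto
  qed
  moreover have "(mat 1 - turn f x, turn f x) \<in> W"
    using in_int \<open>x \<in> T\<close> by (simp add: W_def T_def)
  moreover have "W \<inter> model_surface \<subseteq> (\<lambda>y. (mat 1 - turn f y, turn f y)) ` S"
  proof
    fix p assume p: "p \<in> W \<inter> model_surface"
    then obtain \<sigma> where \<sigma>: "p = (mat 1 - \<sigma>, \<sigma>)" "\<sigma> \<in> SL2" "trace \<sigma> = 1"
      by (auto simp: model_surface_eq)
    have "hcoord \<sigma> \<in> ?h ` T" using p interior_subset by (auto simp: W_def \<sigma>)
    then obtain y where y: "y \<in> T" "hcoord \<sigma> = hcoord (turn f y)" by blast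
    have "height \<sigma> * height (turn f x) > 0" using p by (simp add: W_def \<sigma>)
    moreover have "height (turn f y) * height (turn f x) > 0" using y by (simp add: T_def)
    ultimately have "height \<sigma> * height (turn f y) > 0" by (auto simp: zero_less_mult_iff)
    moreover have "y \<in> S" using y by (simp add: T_def)
    ultimately have "\<sigma> = turn f y"
      using hcoord_height_inject \<sigma> y turn_properties by metis
    then show "p \<in> (\<lambda>y. (mat 1 - turn f y, turn f y)) ` S" using \<sigma> \<open>y \<in> S\<close> by blast
  qed
  ultimately show thesis by (rule that)
qed

lemma left_factor_in:
  assumes "x \<in> S"
  shows "left_factor f x \<in> SLSL"
proof -
  have "turn f x ** (mat 1 - turn f x) = mat 1"
    using turn_square[OF assms] by (simp add: mm_expand)
  then have "det (turn f x) * det (mat 1 - turn f x) = 1" by (metis det_mul det_I)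
  then show ?thesis
    using turn_properties(1)[OF assms] inv[OF assms] by (simp add: left_factor_def ltrans_def SL2_def det_mul)
qed

lemma lpull_left_factor:
  assumes x: "x \<in> S"
  shows "lpull (left_factor f x) (f x) = (mat 1 - turn f x, turn f x)"
proof -
  have "turn f x ** (mat 1 - turn f x) = mat 1" "(mat 1 - turn f x) ** turn f x = mat 1"
    using turn_square[OF x] by (simp_all add: mm_expand)
  then have "f x = ltrans (left_factor f x) (mat 1 - turn f x, turn f x)"
    by (simp add: left_factor_def ltrans_def matrix_mul_assoc[symmetric])
  then show ?thesis
    using lpull_ltrans_SLSL(1)[OF left_factor_in[OF x]] by metis
qed

text \<open>A map with derivative zero is constant on balls.\<close>

lemma left_factor_level_set_open: "open {x \<in> S. left_factor f x = e}"
proof (rule openI)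
  fix x assume "x \<in> {x \<in> S. left_factor f x = e}"
  then have x: "x \<in> S" "left_factor f x = e" by auto
  obtain r where r: "r > 0" "ball x r \<subseteq> S" using open_domain x openE by metis
  have "left_factor f y = e" if "y \<in> ball x r" for y
  proof -
    have "\<And>z. z \<in> ball x r \<Longrightarrow> (left_factor f has_derivative (\<lambda>h. 0)) (at z within ball x r)"
      using left_factor_derivative r(2) has_derivative_at_withinI by blast
    then obtain c where "\<And>z. z \<in> ball x r \<Longrightarrow> left_factor f z = c"
      using has_derivative_zero_constant[OF convex_ball] by metis
    then show ?thesis using that r(1) x(2) by (metis centre_in_ball)
  qed
  then show "\<exists>r>0. ball x r \<subseteq> {x \<in> S. left_factor f x = e}" using r by blast
qed

end

section \<open>Independence of the chart\<close>

text \<open>The chain rule gives one inclusion; for a coordinate change both maps have this form, which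
  gives equality without inverting a derivative.\<close>

lemma tangent_plane_reparametrization:
  assumes "open N" "x \<in> N" "\<And>y. y \<in> N \<Longrightarrow> f y = f' (\<tau> y)"
    and "\<tau> differentiable at x" "f' differentiable at (\<tau> x)"
  shows "tangent_plane f x \<subseteq> tangent_plane f' (\<tau> x)"
proof -
  have "((f' \<circ> \<tau>) has_derivative frechet_derivative f' (at (\<tau> x)) \<circ> frechet_derivative \<tau> (at x)) (at x)"
    using assms(4,5) by (intro diff_chain_at) (simp_all flip: frechet_derivative_works)
  then have "(f has_derivative frechet_derivative f' (at (\<tau> x)) \<circ> frechet_derivative \<tau> (at x)) (at x)"
    by (rule has_derivative_transform_within_open[OF _ assms(1,2)]) (simp add: assms(3))
  from frechet_derivative_at[OF this] show ?thesis
    unfolding tangent_plane_def by (auto simp flip: \<open>_ = frechet_derivative f (at x)\<close>)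
qed

lemma left_factor_cong:
  assumes "f x = f' x'" "tangent_plane f x = tangent_plane f' x'"
  shows "left_factor f x = left_factor f' x'"
  using assms by (simp add: left_factor_def turn_def left_tangent_plane_def)

section \<open>Left translations are isometries\<close>

text \<open>The metric depends only on left-trivialized vectors, and these are unchanged by left translation.
  Stated for \<open>lpull e\<close>, the translation by the inverse of \<open>e\<close>, whose inverse is \<open>ltrans e\<close>.\<close>

lemma isometry_left_translation:
  assumes e: "e \<in> SLSL"
  shows "isometry_SLSL (lpull e)"
proof -
  have det: "det (fst e) = 1" "det (snd e) = 1" using SLSL_det[OF e] by auto
  have lin: "bounded_linear (lpull e)" "bounded_linear (ltrans e)"
    using linear_lpull[of e] ltrans.bounded_linear_right by (simp_all add: linear_conv_bounded_linear)
  have into: "lpull e ` SLSL \<subseteq> SLSL" "ltrans e ` SLSL \<subseteq> SLSL"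
    using e by (auto simp: lpull_def ltrans_def SL2_mult matrix_inv_in_SL2)
  have fd: "frechet_derivative (lpull e) (at p) = lpull e" for p
    by (rule frechet_derivative_at[OF bounded_linear_imp_has_derivative[OF lin(1)], symmetric])
  have g: "g (lpull e p) (lpull e u) (lpull e v) = g p u v"
    if p: "p \<in> SLSL" and uv_in: "u \<in> tangent_SLSL p" "v \<in> tangent_SLSL p" for p u v
  proof -
    obtain \<xi> \<eta> where uv: "u = ltrans p \<xi>" "v = ltrans p \<eta>" using uv_in by (auto simp: tangent_SLSL_def)
    have "lpull e (ltrans p \<zeta>) = ltrans (lpull e p) \<zeta>" for \<zeta>
      by (simp add: lpull_def ltrans_def matrix_mul_assoc)
    moreover have "lpull e p \<in> SLSL" using into p by blast
    ultimately show ?thesis using p by (simp add: uv g_eq_metric0 lpull_ltrans_SLSL)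
  qed
  show ?thesis
    unfolding isometry_SLSL_def fd
  proof (intro conjI exI ballI)
    fix p assume "p \<in> SLSL"
    show "ltrans e (lpull e p) = p" "lpull e (ltrans e p) = p" by (simp_all add: lpull_ltrans det)
  qed (use into g smooth_near_SLSL_bounded_linear[OF lin(1)] smooth_near_SLSL_bounded_linear[OF lin(2)] in auto)
qed

section \<open>From charts to the connected surface\<close>

lemma chart_facts:
  assumes M: "smooth_surface M \<A>" and c: "(U, \<phi>) \<in> \<A>"
  shows "openin M U" "open (\<phi> ` U)" "inj_on \<phi> U"
    and "homeomorphic_map (subtopology M U) (top_of_set (\<phi> ` U)) \<phi>"
    and "topspace (subtopology M U) = U"
proof -
  show *: "openin M U" "open (\<phi> ` U)"
    and h: "homeomorphic_map (subtopology M U) (top_of_set (\<phi> ` U)) \<phi>"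
    using assms by (auto simp: smooth_surface_def)
  show t: "topspace (subtopology M U) = U"
    using openin_subset[OF *(1)] by auto
  show "inj_on \<phi> U" using homeomorphic_imp_injective_map[OF h] t by simp
qed

lemma surface_patch_of_chart:
  assumes "levi_civita D" "almost_complex_surface M \<A> F" "totally_geodesic D \<A> F"
    "P_tangent_to_normal \<A> F" "c \<in> \<A>"
  shows "surface_patch D (in_chart F c) (chart_range c)"
proof
  obtain U \<phi> where c: "c = (U, \<phi>)" by force
  have M: "smooth_surface M \<A>" and imm: "immersion_SLSL M \<A> F"
    using assms(2) by (auto simp: almost_complex_surface_def)
  note ch = chart_facts[OF M, of U \<phi>]
  show "levi_civita D" by fact
  show "open (chart_range c)" using ch assms(5) by (simp add: c chart_range_def)
  show "smooth_on (chart_range c) (in_chart F c)" using imm assms(5) by (simp add: immersion_SLSL_def)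
  fix x assume x: "x \<in> chart_range c"
  show "in_chart F c x \<in> SLSL"
  proof -
    have "inv_into U \<phi> x \<in> U" using x by (auto simp: c chart_range_def intro: inv_into_into)
    then have "inv_into U \<phi> x \<in> topspace M" using ch(1) assms(5) openin_subset c by blast
    then show ?thesis using imm by (auto simp: immersion_SLSL_def in_chart_def c)
  qed
  show "inj (frechet_derivative (in_chart F c) (at x))"
    using imm assms(5) x by (simp add: immersion_SLSL_def)
  show "J (in_chart F c x) ` tangent_plane (in_chart F c) x \<subseteq> tangent_plane (in_chart F c) x"
    using assms(2,5) x by (simp add: almost_complex_surface_def Let_def)
  show "u = 0" if "u \<in> tangent_plane (in_chart F c) x"
    "\<And>v. v \<in> tangent_plane (in_chart F c) x \<Longrightarrow> g (in_chart F c x) u v = 0" for u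
    using assms(2,5) x that by (simp add: almost_complex_surface_def Let_def)
  show "second_fundamental_form D (in_chart F c) x v w = 0" for v w
    using assms(3,5) x by (simp add: totally_geodesic_def)
  show "P (in_chart F c x) ` tangent_plane (in_chart F c) x \<subseteq> Defs.normal_space (in_chart F c) x"
    using assms(4,5) x by (simp add: P_tangent_to_normal_def Let_def)
qed

lemma in_chart_apply:
  assumes "smooth_surface M \<A>" "c \<in> \<A>" "m \<in> fst c"
  shows "in_chart F c (snd c m) = F m" "snd c m \<in> chart_range c"
  using chart_facts(3)[OF assms(1), of "fst c" "snd c"] assms
  by (simp_all add: in_chart_def chart_range_def)

lemma tangent_plane_chart_subset:
  assumes M: "smooth_surface M \<A>" and imm: "immersion_SLSL M \<A> F"
    and c: "c \<in> \<A>" "m \<in> fst c" and d: "d \<in> \<A>" "m \<in> fst d"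
  shows "tangent_plane (in_chart F c) (snd c m) \<subseteq> tangent_plane (in_chart F d) (snd d m)"
proof -
  obtain U \<phi> where cU: "c = (U, \<phi>)" by force
  obtain V \<psi> where dV: "d = (V, \<psi>)" by force
  note chU = chart_facts[OF M c(1)[unfolded cU]] and chV = chart_facts[OF M d(1)[unfolded dV]]
  let ?\<tau> = "\<psi> \<circ> inv_into U \<phi>"
  have inverse_chart: "inv_into U \<phi> (\<phi> k) = k" if "k \<in> U" for k using chU(3) that by simp
  have mUV: "m \<in> U \<inter> V" using c d cU dV by simp
  have "openin (subtopology M U) (U \<inter> V)"
    using chU(1) chV(1) by (simp add: openin_open_subtopology openin_Int)
  then have "openin (top_of_set (\<phi> ` U)) (\<phi> ` (U \<inter> V))"
    using homeomorphic_imp_open_map[OF chU(4)] by (auto simp: open_map_def)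
  then have op: "open (\<phi> ` (U \<inter> V))" using chU(2) by (simp add: openin_open_eq)
  have "smooth_on (\<phi> ` (U \<inter> V)) ?\<tau>" using M c(1) d(1) cU dV by (auto simp: smooth_surface_def)
  then have diff: "?\<tau> differentiable at (\<phi> m)"
    using mUV unfolding smooth_on_def by (auto dest!: spec[of _ "Suc 0"])
  have \<tau>m: "?\<tau> (\<phi> m) = \<psi> m" using inverse_chart mUV by simp
  have "smooth_on (\<psi> ` V) (in_chart F d)" using imm d(1) by (auto simp: immersion_SLSL_def dV chart_range_def)
  then have diff': "in_chart F d differentiable at (?\<tau> (\<phi> m))"
    unfolding \<tau>m using mUV unfolding smooth_on_def by (auto dest!: spec[of _ "Suc 0"])
  have eq: "in_chart F c y = in_chart F d (?\<tau> y)" if "y \<in> \<phi> ` (U \<inter> V)" for y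
    using that inverse_chart chV(3) by (auto simp: in_chart_def cU dV)
  have "tangent_plane (in_chart F c) (\<phi> m) \<subseteq> tangent_plane (in_chart F d) (?\<tau> (\<phi> m))"
    by (rule tangent_plane_reparametrization[OF op imageI[OF mUV] eq diff diff'])
  then show ?thesis using \<tau>m by (simp add: cU dV)
qed

text \<open>Local functions \<open>h i\<close> on a cover that agree on overlaps and are locally constant are glued to a
  constant: the set where the common value is \<open>e\<close> and its complement are both open.\<close>

lemma connected_space_constant:
  assumes M: "connected_space M"
    and cover: "\<And>m. m \<in> topspace M \<Longrightarrow> \<exists>i\<in>I. m \<in> U i"
    and agree: "\<And>i j m. i \<in> I \<Longrightarrow> j \<in> I \<Longrightarrow> m \<in> U i \<Longrightarrow> m \<in> U j \<Longrightarrow> h i m = h j m"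
    and level: "\<And>i e. i \<in> I \<Longrightarrow> openin M {m \<in> U i. h i m = e}"
  shows "\<exists>e. \<forall>i\<in>I. \<forall>m\<in>U i. h i m = e"
proof (cases "\<exists>i\<in>I. \<exists>m. m \<in> U i")
  case False
  then show ?thesis by blast
next
  case True
  then obtain i0 m0 where 0: "i0 \<in> I" "m0 \<in> U i0" by blast
  define e where "e = h i0 m0"
  define E1 where "E1 = (\<Union>i\<in>I. {m \<in> U i. h i m = e})"
  define E2 where "E2 = (\<Union>i\<in>I. \<Union>e'\<in>-{e}. {m \<in> U i. h i m = e'})"
  have op: "openin M E1" "openin M E2"
    unfolding E1_def E2_def by (intro openin_Union ballI | clarsimp simp: level)+
  moreover have "topspace M \<subseteq> E1 \<union> E2"
  proof
    fix m assume "m \<in> topspace M"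
    then obtain i where "i \<in> I" "m \<in> U i" using cover by blast
    then show "m \<in> E1 \<union> E2" by (cases "h i m = e") (auto simp: E1_def E2_def)
  qed
  moreover have "E1 \<inter> E2 = {}"
  proof (rule equals0I)
    fix m assume "m \<in> E1 \<inter> E2"
    then obtain i j where "i \<in> I" "m \<in> U i" "h i m = e" "j \<in> I" "m \<in> U j" "h j m \<noteq> e"
      by (auto simp: E1_def E2_def)
    then show False using agree[of i j m] by simp
  qed
  moreover have "E1 \<noteq> {}" using 0 by (auto simp: E1_def e_def)
  ultimately have "E2 = {}" using M unfolding connected_space_def by blast
  then have "h i m = e" if "i \<in> I" "m \<in> U i" for i m
    using that by (auto simp: E2_def)
  then show ?thesis by (intro exI[of _ e] ballI)
qed

theorem proposition4p5:
  fixes M :: "'m topology" and \<A> :: "'m chart set" and F :: "'m \<Rightarrow> mpair"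
    and D :: "mpair \<Rightarrow> mpair \<Rightarrow> (mpair \<Rightarrow> mpair) \<Rightarrow> mpair"
  assumes "levi_civita D"
    and "almost_complex_surface M \<A> F"
    and "totally_geodesic D \<A> F"
    and "P_tangent_to_normal \<A> F"
  shows "congruent_to_part_of M F model_surface"
proof -
  have M: "smooth_surface M \<A>" and conn: "connected_space M" and imm: "immersion_SLSL M \<A> F"
    using assms(2) by (auto simp: almost_complex_surface_def)
  note patch = surface_patch_of_chart[OF assms]
  note at_chart = in_chart_apply[OF M]
  have cover: "\<exists>c\<in>\<A>. m \<in> fst c" if "m \<in> topspace M" for m
  proof -
    have "topspace M = (\<Union>c\<in>\<A>. fst c)" using M by (simp add: smooth_surface_def split_def)
    then show ?thesis using that by blast
  qed
  have chart_open: "openin M (fst c)" if "c \<in> \<A>" for c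
    using chart_facts(1)[OF M, of "fst c" "snd c"] that by simp
  define e where "e c m = left_factor (in_chart F c) (snd c m)" for c m
  have agree: "e c m = e d m" if "c \<in> \<A>" "d \<in> \<A>" "m \<in> fst c" "m \<in> fst d" for c d m
    unfolding e_def
  proof (rule left_factor_cong)
    show "in_chart F c (snd c m) = in_chart F d (snd d m)"
      using at_chart(1)[of c m F] at_chart(1)[of d m F] that by simp
    show "tangent_plane (in_chart F c) (snd c m) = tangent_plane (in_chart F d) (snd d m)"
      using that by (intro subset_antisym tangent_plane_chart_subset[OF M imm])
  qed
  have level: "openin M {m \<in> fst c. e c m = z}" if c: "c \<in> \<A>" for c z
  proof -
    have "open {x \<in> chart_range c. left_factor (in_chart F c) x = z}"
      by (rule surface_patch.left_factor_level_set_open[OF patch[OF c]])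
    then have "openin (top_of_set (snd c ` fst c)) {x \<in> chart_range c. left_factor (in_chart F c) x = z}"
      by (auto simp: openin_open chart_range_def)
    moreover have "continuous_map (subtopology M (fst c)) (top_of_set (snd c ` fst c)) (snd c)"
      using chart_facts(4)[OF M, of "fst c" "snd c"] c homeomorphic_imp_continuous_map by simp blast
    ultimately have "openin (subtopology M (fst c))
        {m \<in> topspace (subtopology M (fst c)). snd c m \<in> {x \<in> chart_range c. left_factor (in_chart F c) x = z}}"
      using openin_continuous_map_preimage by blast
    also have "{m \<in> topspace (subtopology M (fst c)). snd c m \<in> {x \<in> chart_range c. left_factor (in_chart F c) x = z}}
        = {m \<in> fst c. e c m = z}"
      using openin_subset[OF chart_open[OF c]] by (auto simp: e_def chart_range_def)
    finally show ?thesis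
      using chart_open[OF c] by (simp add: openin_open_subtopology)
  qed
  \<comment> \<open>The left factors of all charts have one common value, whose inverse is the translation required.\<close>
  have "\<exists>e0. \<forall>c\<in>\<A>. \<forall>m\<in>fst c. e c m = e0"
    by (rule connected_space_constant[OF conn]) (fact cover agree level)+
  then obtain e0 where e0: "\<And>c m. c \<in> \<A> \<Longrightarrow> m \<in> fst c \<Longrightarrow> e c m = e0" by blast
  show ?thesis
  proof (cases "topspace M = {}")
    case True
    \<comment> \<open>The empty surface has an empty image, so any isometry will do.\<close>
    have "mat 1 \<in> SL2" by (simp add: SL2_def)
    then have "isometry_SLSL (lpull (mat 1, mat 1))"
      by (intro isometry_left_translation) simp
    then show ?thesis unfolding congruent_to_part_of_def using True by auto
  next
    case False
    then obtain m0 c0 where m0: "m0 \<in> topspace M" "c0 \<in> \<A>" "m0 \<in> fst c0" using cover by blast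
    have "e0 \<in> SLSL"
      using surface_patch.left_factor_in[OF patch[OF m0(2)]] at_chart[OF m0(2,3)] e0[OF m0(2,3)] by (auto simp: e_def)
    then have iso: "isometry_SLSL (lpull e0)" by (rule isometry_left_translation)
    define K where "K = lpull e0 ` F ` topspace M"
    have image: "lpull e0 (in_chart F c x) = (mat 1 - turn (in_chart F c) x, turn (in_chart F c) x)"
      if c: "c \<in> \<A>" and x: "x \<in> chart_range c" for c x
    proof -
      obtain m where m: "m \<in> fst c" "x = snd c m" using x by (auto simp: chart_range_def)
      show ?thesis
        using surface_patch.lpull_left_factor[OF patch[OF c] x] e0[OF c m(1)] by (simp add: e_def m(2))
    qed
    have chart_in_K: "lpull e0 (in_chart F c x) \<in> K" if c: "c \<in> \<A>" and x: "x \<in> chart_range c" for c x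
    proof -
      obtain m where m: "m \<in> fst c" "x = snd c m" using x by (auto simp: chart_range_def)
      then have "m \<in> topspace M" using chart_open[OF c] openin_subset by blast
      then show ?thesis using at_chart(1)[OF c m(1), of F] m by (simp add: K_def)
    qed
    have locally_in: "\<exists>W. open W \<and> q \<in> W \<and> q \<in> model_surface \<and> W \<inter> model_surface \<subseteq> K" if "q \<in> K" for q
    proof -
      from that obtain m where m: "m \<in> topspace M" "q = lpull e0 (F m)" by (auto simp: K_def)
      then obtain c where c: "c \<in> \<A>" "m \<in> fst c" using cover by blast
      let ?x = "snd c m"
      have x: "?x \<in> chart_range c" "in_chart F c ?x = F m" using at_chart[OF c] by auto
      interpret surface_patch D "in_chart F c" "chart_range c" by (rule patch[OF c(1)])
      obtain W where W: "open W" "(mat 1 - turn (in_chart F c) ?x, turn (in_chart F c) ?x) \<in> W"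
        "W \<inter> model_surface \<subseteq> (\<lambda>y. (mat 1 - turn (in_chart F c) y, turn (in_chart F c) y)) ` chart_range c"
        using turn_open_in_model[OF x(1)] .
      have q: "q = (mat 1 - turn (in_chart F c) ?x, turn (in_chart F c) ?x)"
        using image[OF c(1) x(1)] x(2) m(2) by simp
      have "q \<in> model_surface" using turn_properties[OF x(1)] by (auto simp: q model_surface_eq)
      moreover have "W \<inter> model_surface \<subseteq> K"
      proof
        fix p assume "p \<in> W \<inter> model_surface"
        then obtain y where y: "y \<in> chart_range c" "p = lpull e0 (in_chart F c y)"
          using W(3) image[OF c(1)] by fastforce
        then show "p \<in> K" using chart_in_K[OF c(1)] by simp
      qed
      ultimately show ?thesis using W q by blast
    qed
    have "openin (top_of_set model_surface) K"
    proof (subst openin_subopen, intro ballI)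
      fix q assume "q \<in> K"
      then obtain W where W: "open W" "q \<in> W" "q \<in> model_surface" "W \<inter> model_surface \<subseteq> K"
        using locally_in by blast
      then show "\<exists>T. openin (top_of_set model_surface) T \<and> q \<in> T \<and> T \<subseteq> K"
        by (intro exI[of _ "model_surface \<inter> W"]) (auto simp: openin_open)
    qed
    then show ?thesis
      unfolding congruent_to_part_of_def K_def using iso by blast
  qed
qed

end
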